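(* Let $\mathcal H$ be a Hilbert space, $n\in\mathbb N$, and let $F\in\left(C(S^1)_{(n)}\otimes_{\rm min}\mathcal B(\mathcal H)\right)_+$, considered as a function $F(z)=\sum_{\ell=-n+1}^{n-1}z^\ell\tau_\ell$ of $z\in S^1$, with $\tau_\ell\in\mathcal B(\mathcal H)$. If $F$ is pure, then there exists an operator $w:\mathcal H\rightarrow\mathbb C^n$ such that $$F(z)=w^*T_n(z^{-1})w,$$ for every $z\in S^1$.
   Context: Hilbert spaces are complex and of arbitrary (finite or infinite) dimension; operators between Hilbert spaces are bounded and linear; $\mathcal B(\mathcal H)$ is the algebra of bounded linear operators on $\mathcal H$; $S^1\subset\mathbb C$ is the unit circle; $\mathbb C^n$ carries the standard inner product. $C(S^1)_{(n)}$ is the operator system of all functions $f:S^1\to\mathbb C$ of the form $f(z)=\sum_{k=-n+1}^{n-1}\alpha_kz^k$, a subsystem of the C$^*$-algebra $C(S^1)$ of continuous functions on $S^1$. Elements of $C(S^1)_{(n)}\otimes_{\rm min}\mathcal B(\mathcal H)$ are identified with functions $F:S^1\to\mathcal B(\mathcal H)$ of the form $F(z)=\sum_{\ell=-n+1}^{n-1}z^\ell\tau_\ell$, and $F$ is positive iff $F(z)$ is a positive operator for every $z\in S^1$ (here $\otimes_{\rm min}$ is the spatial operator system tensor product). For $z\in S^1$, $T_n(z)=[z^{k-j}]_{k,j=1}^n\in\mathcal M_n(\mathbb C)$. An element $\phi$ of a convex cone $\mathcal C$ is pure if the equation $\vartheta+\omega=\phi$, with $\vartheta,\omega\in\mathcal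 C$, holds only if there is a scalar $s\in[0,1]$ with $\vartheta=s\phi$ and $\omega=(1-s)\phi$. Here the cone is $\left(C(S^1)_{(n)}\otimes_{\rm min}\mathcal B(\mathcal H)\right)_+$. *)

theory Defs
  imports "HOL-Analysis.Analysis"
begin

subsection \<open>Complex Hilbert spaces\<close>

class complex_vector = real_vector +
  fixes scaleC :: "complex \<Rightarrow> 'a \<Rightarrow> 'a"  (infixr \<open>*\<^sub>C\<close> 75)
  assumes scaleC_add_right: "a *\<^sub>C (x + y) = a *\<^sub>C x + a *\<^sub>C y"
    and scaleC_add_left: "(a + b) *\<^sub>C x = a *\<^sub>C x + b *\<^sub>C x"
    and scaleC_scaleC: "a *\<^sub>C (b *\<^sub>C x) = (a * b) *\<^sub>C x"
    and scaleC_one: "1 *\<^sub>C x = x"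
    and scaleR_scaleC: "r *\<^sub>R x = complex_of_real r *\<^sub>C x"

text \<open>The inner product is conjugate-linear in its first argument.\<close>

class complex_inner = complex_vector + real_normed_vector +
  fixes cinner :: "'a \<Rightarrow> 'a \<Rightarrow> complex"
  assumes cinner_commute: "cinner x y = cnj (cinner y x)"
    and cinner_add_right: "cinner x (y + z) = cinner x y + cinner x z"
    and cinner_scaleC_right: "cinner x (a *\<^sub>C y) = a * cinner x y"
    and cinner_self: "cinner x x = complex_of_real ((norm x)\<^sup>2)"

class chilbert_space = complex_inner + complete_space

instantiation complex :: chilbert_space
begin

definition scaleC_complex :: "complex \<Rightarrow> complex \<Rightarrow> complex"
  where "scaleC_complex a x = a * x"

definition cinner_complex :: "complex \<Rightarrow> complex \<Rightarrow> complex"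
  where "cinner_complex x y = cnj x * y"

instance
proof
  fix x :: complex
  show "cinner x x = complex_of_real ((norm x)\<^sup>2)"
    by (metis cinner_complex_def complex_norm_square mult.commute)
qed (simp_all add: scaleC_complex_def cinner_complex_def algebra_simps scaleR_conv_of_real)

end

instantiation vec :: (complex_vector, finite) complex_vector
begin

definition scaleC_vec :: "complex \<Rightarrow> 'a ^ 'b \<Rightarrow> 'a ^ 'b"
  where "scaleC_vec a x = (\<chi> i. a *\<^sub>C (x $ i))"

instance
  by standard (simp_all add: scaleC_vec_def vec_eq_iff scaleC_add_right scaleC_add_left
      scaleC_scaleC scaleC_one scaleR_scaleC)

end

instantiation vec :: (chilbert_space, finite) chilbert_space
begin

definition cinner_vec :: "'a ^ 'b \<Rightarrow> 'a ^ 'b \<Rightarrow> complex"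
  where "cinner_vec x y = (\<Sum>i\<in>UNIV. cinner (x $ i) (y $ i))"

instance
proof
  fix x y z :: "'a ^ 'b" and a :: complex
  show "cinner x y = cnj (cinner y x)"
    unfolding cinner_vec_def cnj_sum by (rule sum.cong[OF refl]) (rule cinner_commute)
  show "cinner x (y + z) = cinner x y + cinner x z"
    by (simp add: cinner_vec_def cinner_add_right sum.distrib)
  show "cinner x (a *\<^sub>C y) = a * cinner x y"
    by (simp add: cinner_vec_def scaleC_vec_def cinner_scaleC_right sum_distrib_left)
  show "cinner x x = complex_of_real ((norm x)\<^sup>2)"
    by (simp add: cinner_vec_def cinner_self norm_vec_def L2_set_def sum_nonneg)
qed

end


subsection \<open>Bounded operators\<close>

definition bounded_clinear :: "('a::complex_inner \<Rightarrow> 'b::complex_inner) \<Rightarrow> bool"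
  where "bounded_clinear f \<longleftrightarrow>
    (\<forall>x y. f (x + y) = f x + f y) \<and> (\<forall>a x. f (a *\<^sub>C x) = a *\<^sub>C f x) \<and>
    (\<exists>K. \<forall>x. norm (f x) \<le> K * norm x)"

lemma bounded_clinear_iff:
  "bounded_clinear f \<longleftrightarrow> bounded_linear f \<and> (\<forall>a x. f (a *\<^sub>C x) = a *\<^sub>C f x)"
proof
  assume f: "bounded_clinear f"
  then obtain K where "\<forall>x. norm (f x) \<le> K * norm x"
    by (auto simp: bounded_clinear_def)
  with f show "bounded_linear f \<and> (\<forall>a x. f (a *\<^sub>C x) = a *\<^sub>C f x)"
    by (auto simp: bounded_clinear_def scaleR_scaleC mult.commute
        intro!: bounded_linear_intro[where K = K])
next
  assume "bounded_linear f \<and> (\<forall>a x. f (a *\<^sub>C x) = a *\<^sub>C f x)"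
  moreover from this obtain K where "\<forall>x. norm (f x) \<le> norm x * K"
    using bounded_linear.bounded by blast
  ultimately show "bounded_clinear f"
    by (auto simp: bounded_clinear_def mult.commute linear_add bounded_linear.linear)
qed

typedef (overloaded) ('a, 'b) cblinfun  (\<open>(_ \<Rightarrow>\<^sub>C\<^sub>L /_)\<close> [22, 21] 21) =
  "{f :: 'a::complex_inner \<Rightarrow> 'b::complex_inner. bounded_clinear f}"
  morphisms cblinfun_apply CBlinfun
  by (rule exI[of _ "\<lambda>_. 0"])
     (simp add: bounded_clinear_iff, metis add_cancel_right_left scaleC_add_right)

setup_lifting type_definition_cblinfun

instantiation cblinfun :: (complex_inner, complex_inner) complex_vector
begin

lift_definition zero_cblinfun :: "'a \<Rightarrow>\<^sub>C\<^sub>L 'b" is "\<lambda>_. 0"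
  by (simp add: bounded_clinear_iff) (metis add_cancel_right_left scaleC_add_right)

lift_definition plus_cblinfun :: "'a \<Rightarrow>\<^sub>C\<^sub>L 'b \<Rightarrow> 'a \<Rightarrow>\<^sub>C\<^sub>L 'b \<Rightarrow> 'a \<Rightarrow>\<^sub>C\<^sub>L 'b"
  is "\<lambda>f g x. f x + g x"
  by (simp add: bounded_clinear_iff bounded_linear_add scaleC_add_right)

lift_definition scaleC_cblinfun :: "complex \<Rightarrow> 'a \<Rightarrow>\<^sub>C\<^sub>L 'b \<Rightarrow> 'a \<Rightarrow>\<^sub>C\<^sub>L 'b"
  is "\<lambda>a f x. a *\<^sub>C f x"
proof -
  fix a :: complex and f :: "'a \<Rightarrow> 'b"
  assume f: "bounded_clinear f"
  then obtain K where K: "\<And>x. norm (f x) \<le> K * norm x"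
    by (auto simp: bounded_clinear_def)
  have nrm: "norm (a *\<^sub>C y) = norm a * norm y" for y :: 'b
  proof -
    have "complex_of_real ((norm (a *\<^sub>C y))\<^sup>2) = cinner (a *\<^sub>C y) (a *\<^sub>C y)"
      by (simp add: cinner_self)
    also have "\<dots> = a * cnj (cinner y (a *\<^sub>C y))"
      by (metis cinner_scaleC_right cinner_commute)
    also have "\<dots> = (a * cnj a) * cnj (cinner y y)"
      by (simp add: cinner_scaleC_right)
    also have "\<dots> = complex_of_real ((norm a * norm y)\<^sup>2)"
      by (simp add: cinner_self power_mult_distrib flip: complex_norm_square)
    finally have "(norm (a *\<^sub>C y))\<^sup>2 = (norm a * norm y)\<^sup>2"
      using of_real_eq_iff by blast
    then show ?thesis by simp
  qed
  have "norm (a *\<^sub>C f x) \<le> (norm a * K) * norm x" for x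
    using mult_left_mono[OF K[of x], of "norm a"] by (simp add: nrm mult.assoc)
  then have "\<exists>K. \<forall>x. norm (a *\<^sub>C f x) \<le> K * norm x"
    by blast
  then show "bounded_clinear (\<lambda>x. a *\<^sub>C f x)"
    using f by (simp add: bounded_clinear_def scaleC_add_right scaleC_scaleC mult.commute)
qed

definition uminus_cblinfun :: "'a \<Rightarrow>\<^sub>C\<^sub>L 'b \<Rightarrow> 'a \<Rightarrow>\<^sub>C\<^sub>L 'b"
  where "- (f :: 'a \<Rightarrow>\<^sub>C\<^sub>L 'b) = (-1) *\<^sub>C f"

definition minus_cblinfun :: "'a \<Rightarrow>\<^sub>C\<^sub>L 'b \<Rightarrow> 'a \<Rightarrow>\<^sub>C\<^sub>L 'b \<Rightarrow> 'a \<Rightarrow>\<^sub>C\<^sub>L 'b"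
  where "f - g = f + (-1) *\<^sub>C (g :: 'a \<Rightarrow>\<^sub>C\<^sub>L 'b)"

definition scaleR_cblinfun :: "real \<Rightarrow> 'a \<Rightarrow>\<^sub>C\<^sub>L 'b \<Rightarrow> 'a \<Rightarrow>\<^sub>C\<^sub>L 'b"
  where "r *\<^sub>R f = complex_of_real r *\<^sub>C (f :: 'a \<Rightarrow>\<^sub>C\<^sub>L 'b)"

instance
proof
  fix f g h :: "'a \<Rightarrow>\<^sub>C\<^sub>L 'b" and a b :: complex and r s :: real
  show "f + g + h = f + (g + h)" by transfer (simp add: add.assoc)
  show "f + g = g + f" by transfer (simp add: add.commute)
  show "0 + f = f" by transfer simp
  have neg: "(-1) *\<^sub>C y + y = 0" for y :: 'b
    by (metis scaleC_add_left scaleC_one add.left_inverse add_cancel_right_left)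
  show "- f + f = 0"
    unfolding uminus_cblinfun_def by transfer (simp add: neg)
  show "f - g = f + - g"
    by (simp add: uminus_cblinfun_def minus_cblinfun_def)
  show C1: "a *\<^sub>C (f + g) = a *\<^sub>C f + a *\<^sub>C g" for a :: complex
    by transfer (simp add: scaleC_add_right)
  show C2: "(a + b) *\<^sub>C f = a *\<^sub>C f + b *\<^sub>C f" for a b :: complex
    by transfer (simp add: scaleC_add_left)
  show C3: "a *\<^sub>C b *\<^sub>C f = (a * b) *\<^sub>C f" for a b :: complex
    by transfer (simp add: scaleC_scaleC)
  show C4: "1 *\<^sub>C f = f" by transfer (simp add: scaleC_one)
  show "r *\<^sub>R f = complex_of_real r *\<^sub>C f" by (simp add: scaleR_cblinfun_def)
  show "r *\<^sub>R (f + g) = r *\<^sub>R f + r *\<^sub>R g" by (simp add: scaleR_cblinfun_def C1)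
  show "(r + s) *\<^sub>R f = r *\<^sub>R f + s *\<^sub>R f" by (simp add: scaleR_cblinfun_def C2)
  show "r *\<^sub>R s *\<^sub>R f = (r * s) *\<^sub>R f" by (simp add: scaleR_cblinfun_def C3)
  show "1 *\<^sub>R f = f" by (simp add: scaleR_cblinfun_def C4)
qed

end

lift_definition cblinfun_compose ::
    "'b::complex_inner \<Rightarrow>\<^sub>C\<^sub>L 'c::complex_inner \<Rightarrow> 'a::complex_inner \<Rightarrow>\<^sub>C\<^sub>L 'b \<Rightarrow> 'a \<Rightarrow>\<^sub>C\<^sub>L 'c"
    (infixl \<open>o\<^sub>C\<^sub>L\<close> 67)
  is "\<lambda>f g x. f (g x)"
  by (simp add: bounded_clinear_iff bounded_linear_compose)

lift_definition cblinfun_of_matrix :: "complex ^ 'n ^ 'm \<Rightarrow> (complex ^ 'n) \<Rightarrow>\<^sub>C\<^sub>L (complex ^ 'm)"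
  is "\<lambda>A x. A *v x"
proof -
  fix A :: "complex ^ 'n ^ 'm"
  have "linear ((*v) A)"
    by (rule linearI) (simp_all add: matrix_vector_mult_def vec_eq_iff
        scaleR_sum_right distrib_left sum.distrib)
  then have "bounded_linear ((*v) A)"
    by (simp add: linear_conv_bounded_linear)
  moreover have "A *v (a *\<^sub>C x) = a *\<^sub>C (A *v x)" for a x
    by (simp add: matrix_vector_mult_def scaleC_vec_def scaleC_complex_def vec_eq_iff
        sum_distrib_left mult.left_commute)
  ultimately show "bounded_clinear ((*v) A)"
    by (simp add: bounded_clinear_iff)
qed

text \<open>The adjoint is determined uniquely by the equation below; it exists because both spaces are
  complete.\<close>

definition cadjoint :: "'a::chilbert_space \<Rightarrow>\<^sub>C\<^sub>L 'b::chilbert_space \<Rightarrow> 'b \<Rightarrow>\<^sub>C\<^sub>L 'a"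
  where "cadjoint A =
    (THE B. \<forall>x y. cinner (cblinfun_apply B y) x = cinner y (cblinfun_apply A x))"

lemma cadjoint_eqI:
  assumes B: "\<And>x y. cinner (cblinfun_apply B y) x = cinner y (cblinfun_apply A x)"
  shows "cadjoint A = B"
  unfolding cadjoint_def
proof (rule the_equality)
  show "\<forall>x y. cinner (cblinfun_apply B y) x = cinner y (cblinfun_apply A x)"
    using B by simp
next
  fix B'
  assume B': "\<forall>x y. cinner (cblinfun_apply B' y) x = cinner y (cblinfun_apply A x)"
  have "cblinfun_apply B' y = cblinfun_apply B y" for y
  proof -
    define d where "d = cblinfun_apply B' y - cblinfun_apply B y"
    have "cinner d (cblinfun_apply B' y) = cinner d (cblinfun_apply B y)"
      by (metis B B' cinner_commute)
    moreover have "cinner d (cblinfun_apply B' y) = cinner d d + cinner d (cblinfun_apply B y)"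
      by (simp add: d_def flip: cinner_add_right)
    ultimately have "cinner d d = 0" by simp
    then show ?thesis by (simp add: cinner_self d_def)
  qed
  then show "B' = B"
    by (simp add: cblinfun_apply_inject[symmetric] fun_eq_iff)
qed

definition positive_cblinfun :: "'a::chilbert_space \<Rightarrow>\<^sub>C\<^sub>L 'a \<Rightarrow> bool"
  where "positive_cblinfun A \<longleftrightarrow> (\<forall>x. cinner x (cblinfun_apply A x) \<in> \<real>\<^sub>\<ge>\<^sub>0)"


subsection \<open>Operator-valued trigonometric polynomials\<close>

abbreviation unit_circle :: "complex set"
  where "unit_circle \<equiv> sphere 0 1"

text \<open>A function on the circle is represented by a total function on the complex numbers whose
  values off the circle are irrelevant; equality of such functions is always taken on the circle.\<close>

definition trig_polys :: "nat \<Rightarrow> (complex \<Rightarrow> 'a::chilbert_space \<Rightarrow>\<^sub>C\<^sub>L 'a) set"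
  where "trig_polys n = {F. \<exists>\<tau> :: int \<Rightarrow> 'a \<Rightarrow>\<^sub>C\<^sub>L 'a.
    \<forall>z\<in>unit_circle. F z = (\<Sum>l = - int n + 1..int n - 1. (z powi l) *\<^sub>C \<tau> l)}"

definition positive_trig_polys :: "nat \<Rightarrow> (complex \<Rightarrow> 'a::chilbert_space \<Rightarrow>\<^sub>C\<^sub>L 'a) set"
  where "positive_trig_polys n =
    {F \<in> trig_polys n. \<forall>z\<in>unit_circle. positive_cblinfun (F z)}"

definition pure_in :: "(complex \<Rightarrow> 'b::real_vector) set \<Rightarrow> (complex \<Rightarrow> 'b) \<Rightarrow> bool"
  where "pure_in C F \<longleftrightarrow> F \<in> C \<and>
    (\<forall>\<theta>\<in>C. \<forall>\<omega>\<in>C. (\<forall>z\<in>unit_circle. \<theta> z + \<omega> z = F z) \<longrightarrow>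
      (\<exists>s\<in>{0..1}. (\<forall>z\<in>unit_circle. \<theta> z = s *\<^sub>R F z) \<and>
                  (\<forall>z\<in>unit_circle. \<omega> z = (1 - s) *\<^sub>R F z)))"

text \<open>The linear order on \<open>'n\<close> numbers its elements \<open>0, \<dots>, CARD('n) - 1\<close>; numbering from \<open>0\<close>
  rather than \<open>1\<close> does not affect the differences \<open>k - j\<close>.\<close>

definition index_of :: "'n::{finite,linorder} \<Rightarrow> nat"
  where "index_of k = card {..<k}"

definition toeplitz :: "complex \<Rightarrow> complex ^ 'n::{finite,linorder} ^ 'n::{finite,linorder}"
  where "toeplitz z = (\<chi> k j. z powi (int (index_of k) - int (index_of j)))"

end

theory Submission
  imports Defs
begin

text \<open>Write \<open>n = d + 1\<close>. Positivity of \<open>F\<close> makes the infinite block Toeplitz form with entries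
  \<open>\<tau>\<^bsub>k-j\<^esub>\<close> nonnegative. Let \<open>Q\<^sub>m\<close> be its Schur complement on the first \<open>m\<close> coordinates. Since
  \<open>\<tau>\<close> is banded and the matrix reproduces itself after deleting the first row and column,
  \<open>Q\<^sub>n(x)\<close> equals \<open>Q\<^sub>d(x\<^sub>1, \<dots>, x\<^sub>d)\<close> plus the explicit contribution of row and column \<open>0\<close>.
  Hence \<open>A = Q\<^sub>n - Q\<^sub>d\<close> is a nonnegative quadratic form on \<open>\<H>\<^sup>n\<close>, and at the geometric vector
  \<open>x\<^sub>k = z\<^sup>k h\<close> its value is \<open>\<langle>h, F(z) h\<rangle>\<close>. By Cauchy--Schwarz, \<open>A\<close> dominates a rank one form
  \<open>|f|\<^sup>2\<close> agreeing with it at a chosen geometric vector. The components of \<open>f\<close> define \<open>w\<close>, so that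
  \<open>w\<^sup>* T\<^sub>n(z\<inverse>) w \<le> F(z)\<close> on the circle with equality of the quadratic forms at one point where
  they do not vanish. Purity gives \<open>w\<^sup>* T\<^sub>n(z\<inverse>) w = s F(z)\<close>, and equality at that point
  forces \<open>s = 1\<close>.\<close>

subsection \<open>Complex inner products and bounded operators\<close>

lemma scaleC_zero_left [simp]: "0 *\<^sub>C (x::'a::complex_vector) = 0"
  by (metis scaleC_add_left add_cancel_right_left)

lemma scaleC_zero_right [simp]: "a *\<^sub>C (0::'a::complex_vector) = 0"
  by (metis scaleC_add_right add_cancel_right_left)

lemma scaleC_minus_right: "a *\<^sub>C (- (x::'a::complex_vector)) = - (a *\<^sub>C x)"
  by (metis scaleC_add_right scaleC_zero_right add_eq_0_iff)

lemma scaleC_minus_left: "(- a) *\<^sub>C (x::'a::complex_vector) = - (a *\<^sub>C x)"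
  by (metis scaleC_add_left scaleC_zero_left add_eq_0_iff)

lemma scaleC_diff_right: "a *\<^sub>C (x - (y::'a::complex_vector)) = a *\<^sub>C x - a *\<^sub>C y"
  using scaleC_add_right[of a x "- y"] by (simp add: scaleC_minus_right)

lemma scaleC_sum_right: "a *\<^sub>C (sum g S) = (\<Sum>i\<in>S. a *\<^sub>C (g i :: 'a::complex_vector))"
  by (induction S rule: infinite_finite_induct) (simp_all add: scaleC_add_right)

lemma scaleC_sum_left: "(sum g S) *\<^sub>C x = (\<Sum>i\<in>S. g i *\<^sub>C (x :: 'a::complex_vector))"
  by (induction S rule: infinite_finite_induct) (simp_all add: scaleC_add_left)

lemma cinner_add_left: "cinner (x + y) z = cinner x z + cinner (y::'a::complex_inner) z"
  by (subst (1 2 3) cinner_commute) (simp add: cinner_add_right)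

lemma cinner_scaleC_left: "cinner (a *\<^sub>C x) (y::'a::complex_inner) = cnj a * cinner x y"
  by (subst (1 2) cinner_commute) (simp add: cinner_scaleC_right)

lemma cinner_zero_right [simp]: "cinner x (0::'a::complex_inner) = 0"
  by (metis cinner_add_right add_cancel_right_left)

lemma cinner_zero_left [simp]: "cinner (0::'a::complex_inner) x = 0"
  by (metis cinner_add_left add_cancel_right_left)

lemma cinner_minus_right: "cinner x (- (y::'a::complex_inner)) = - cinner x y"
  by (metis cinner_add_right cinner_zero_right add_eq_0_iff)

lemma cinner_minus_left: "cinner (- (x::'a::complex_inner)) y = - cinner x y"
  by (metis cinner_add_left cinner_zero_left add_eq_0_iff)

lemma cinner_diff_right: "cinner x (y - (z::'a::complex_inner)) = cinner x y - cinner x z"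
  using cinner_add_right[of x y "- z"] by (simp add: cinner_minus_right)

lemma cinner_diff_left: "cinner (x - (y::'a::complex_inner)) z = cinner x z - cinner y z"
  using cinner_add_left[of x "- y" z] by (simp add: cinner_minus_left)

lemma cinner_sum_right: "cinner x (sum g S) = (\<Sum>i\<in>S. cinner x (g i :: 'a::complex_inner))"
  by (induction S rule: infinite_finite_induct) (simp_all add: cinner_add_right)

lemma cinner_sum_left: "cinner (sum g S) x = (\<Sum>i\<in>S. cinner (g i :: 'a::complex_inner) x)"
  by (induction S rule: infinite_finite_induct) (simp_all add: cinner_add_left)

lemma Re_cinner_self: "Re (cinner x x) = (norm (x::'a::complex_inner))\<^sup>2"
  by (simp add: cinner_self)

lemma norm_scaleC: "norm (a *\<^sub>C (x::'a::complex_inner)) = cmod a * norm x"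
proof -
  have "complex_of_real ((norm (a *\<^sub>C x))\<^sup>2) = (a * cnj a) * cinner x x"
    by (simp only: flip: cinner_self) (simp add: cinner_scaleC_right cinner_scaleC_left)
  also have "\<dots> = complex_of_real ((cmod a * norm x)\<^sup>2)"
    by (simp add: cinner_self power_mult_distrib flip: complex_norm_square)
  finally have "(norm (a *\<^sub>C x))\<^sup>2 = (cmod a * norm x)\<^sup>2"
    using of_real_eq_iff by blast
  then show ?thesis by simp
qed

lemma norm_add_square:
  "(norm (x + y))\<^sup>2 = (norm x)\<^sup>2 + 2 * Re (cinner x y) + (norm (y::'a::complex_inner))\<^sup>2"
proof -
  have "Re (cinner y x) = Re (cinner x y)"
    by (metis cinner_commute complex_cnj(1) complex.sel(1) complex_surj)
  then show ?thesis
    by (simp flip: Re_cinner_self add: cinner_add_left cinner_add_right)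
qed

text \<open>Rotating a vector by \<open>c\<close> turns a bound on the real part of a linear
  functional into a bound on its modulus.\<close>

lemma unit_rotation:
  obtains c where "cmod c = 1" "c * (a::complex) = of_real (cmod a)"
proof (cases "a = 0")
  case True
  then show ?thesis using that[of 1] by simp
next
  case False
  then have "cnj a / of_real (cmod a) * a = of_real (cmod a)"
    by (simp add: field_simps power2_eq_square flip: complex_norm_square)
  with False show ?thesis
    using that[of "cnj a / of_real (cmod a)"] by (simp add: norm_divide)
qed

lemma cnj_unit_circle: "z \<in> unit_circle \<Longrightarrow> cnj z = inverse z"
  using complex_norm_square[of z] by (simp add: inverse_unique)

text \<open>The triangle inequality belongs to the normed space structure; squaring it bounds the
  real part, and a rotation of \<open>y\<close> passes to the modulus.\<close>

lemma cinner_Cauchy_Schwarz: "cmod (cinner x y) \<le> norm x * norm (y::'a::complex_inner)"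
proof -
  have Re: "Re (cinner x y) \<le> norm x * norm y" for x y :: 'a
  proof -
    have "(norm (x + y))\<^sup>2 \<le> (norm x + norm y)\<^sup>2"
      by (simp add: power_mono norm_triangle_ineq)
    then show ?thesis
      by (simp add: norm_add_square power2_sum)
  qed
  obtain c where c: "cmod c = 1" "c * cinner x y = of_real (cmod (cinner x y))"
    by (rule unit_rotation)
  then show ?thesis
    using Re[of x "c *\<^sub>C y"] by (simp add: cinner_scaleC_right norm_scaleC)
qed

section \<open>Pointwise rules for bounded operators\<close>

lemma cblinfun_apply_bounded_clinear: "bounded_clinear (cblinfun_apply A)"
  using cblinfun_apply[of A] by simp

lemma cblinfun_apply_add_right: "cblinfun_apply A (x + y) = cblinfun_apply A x + cblinfun_apply A y"
  using cblinfun_apply_bounded_clinear[of A] by (simp add: bounded_clinear_def)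

lemma cblinfun_apply_scaleC_right: "cblinfun_apply A (c *\<^sub>C x) = c *\<^sub>C cblinfun_apply A x"
  using cblinfun_apply_bounded_clinear[of A] by (simp add: bounded_clinear_def)

lemma cblinfun_apply_zero_right [simp]: "cblinfun_apply A 0 = 0"
  by (metis cblinfun_apply_add_right add_cancel_right_left)

lemma cblinfun_apply_diff_right: "cblinfun_apply A (x - y) = cblinfun_apply A x - cblinfun_apply A y"
  by (metis cblinfun_apply_add_right add_diff_cancel_right' diff_add_cancel)

lemma cblinfun_apply_sum_right: "cblinfun_apply A (sum g S) = (\<Sum>i\<in>S. cblinfun_apply A (g i))"
  by (induction S rule: infinite_finite_induct) (simp_all add: cblinfun_apply_add_right)

lemma cblinfun_apply_sum_left: "cblinfun_apply (sum A S) x = (\<Sum>i\<in>S. cblinfun_apply (A i) x)"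
  by (induction S rule: infinite_finite_induct)
    (simp_all add: zero_cblinfun.rep_eq plus_cblinfun.rep_eq)

lemma cblinfun_apply_diff_left: "cblinfun_apply (A - B) x = cblinfun_apply A x - cblinfun_apply B x"
  by (metis add_diff_cancel_right' diff_add_cancel plus_cblinfun.rep_eq)

lemma cblinfun_eqI:
  assumes "\<And>x. cblinfun_apply A x = cblinfun_apply B x"
  shows "A = B"
  using assms by (simp add: cblinfun_apply_inject[symmetric] fun_eq_iff)

text \<open>Minimize \<open>J x = \<parallel>x\<parallel>\<^sup>2 - 2 Re (f x)\<close>: by the parallelogram law, minimizing sequences
  are Cauchy.\<close>

lemma Riesz_representation:
  fixes f :: "'a::chilbert_space \<Rightarrow> complex"
  assumes add: "\<And>x y. f (x + y) = f x + f y" and scale: "\<And>a x. f (a *\<^sub>C x) = a * f x"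
    and bound: "\<And>x. cmod (f x) \<le> K * norm x"
  obtains u where "\<And>x. f x = cinner u x"
proof -
  define J where "J x = (norm x)\<^sup>2 - 2 * Re (f x)" for x
  define m where "m = Inf (range J)"
  \<comment> \<open>Completing the square: \<open>J x\<close> is at least
    \<open>(norm x - K)^2 - K^2\<close>.\<close>
  have lower: "- K\<^sup>2 \<le> J x" for x
  proof -
    have "Re (f x) \<le> K * norm x"
      using bound[of x] complex_Re_le_cmod order_trans by blast
    moreover have "0 \<le> (norm x - K)\<^sup>2"
      by simp
    ultimately show ?thesis
      by (simp add: J_def power2_diff algebra_simps)
  qed
  have bdd: "bdd_below (range J)"
    using lower by (intro bdd_belowI) auto
  have m_le: "m \<le> J x" for x
    unfolding m_def using bdd by (intro cInf_lower) auto
  have "\<exists>x. J x < m + 1 / real (Suc k)" for k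
    using cInf_lessD[of "range J" "m + 1 / real (Suc k)"] by (auto simp: m_def)
  then obtain X where X: "\<And>k. J (X k) < m + 1 / real (Suc k)"
    by metis
  have half: "f ((1/2) *\<^sub>C (x + y)) = (f x + f y) / 2" for x y
    by (simp add: scale add)
  have close: "(norm (x - y))\<^sup>2 \<le> 2 * (J x - m) + 2 * (J y - m)" for x y
  proof -
    have "m \<le> J ((1/2) *\<^sub>C (x + y))"
      by (rule m_le)
    moreover have "(norm (x - y))\<^sup>2 = (norm x)\<^sup>2 - 2 * Re (cinner x y) + (norm y)\<^sup>2"
      using norm_add_square[of x "- y"] by (simp add: cinner_minus_right)
    ultimately show ?thesis
      by (simp add: J_def half norm_scaleC power_divide norm_add_square field_simps)
  qed
  have "Cauchy X"
  proof (rule metric_CauchyI)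
    fix e :: real assume e: "0 < e"
    obtain k0 :: nat where k0: "4 / e\<^sup>2 < real k0"
      using reals_Archimedean2 by blast
    have "dist (X i) (X j) < e" if "k0 \<le> i" "k0 \<le> j" for i j
    proof -
      have small: "J (X k) < m + e\<^sup>2 / 4" if "k0 \<le> k" for k
      proof -
        have "4 / e\<^sup>2 < real (Suc k)"
          using k0 that by linarith
        then have "1 / real (Suc k) < e\<^sup>2 / 4"
          using e by (simp add: field_simps)
        with X[of k] show ?thesis
          by (meson add_strict_left_mono order.strict_trans)
      qed
      have "2 * (J (X k) - m) < e\<^sup>2 / 2" if "k0 \<le> k" for k
        using small[OF that] by simp
      from close[of "X i" "X j"] add_strict_mono[OF this[OF that(1)] this[OF that(2)]]
      have "(norm (X i - X j))\<^sup>2 < e\<^sup>2"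
        by simp
      then show ?thesis
        using e by (simp add: dist_norm power2_less_imp_less)
    qed
    then show "\<exists>M. \<forall>i\<ge>M. \<forall>j\<ge>M. dist (X i) (X j) < e"
      by blast
  qed
  then obtain u where u: "X \<longlonglongrightarrow> u"
    using Cauchy_convergent_iff convergent_def by blast
  have "bounded_linear f"
    using add bound scale by (intro bounded_linear_intro[of _ K])
      (auto simp: scaleR_scaleC scaleC_complex_def mult.commute)
  then have "(\<lambda>k. f (X k)) \<longlonglongrightarrow> f u"
    using u by (rule bounded_linear.tendsto)
  then have "(\<lambda>k. J (X k)) \<longlonglongrightarrow> J u"
    unfolding J_def by (intro tendsto_intros u)
  moreover have "(\<lambda>k. m + 1 / real (Suc k)) \<longlonglongrightarrow> m + 0"
    by (intro tendsto_intros LIMSEQ_Suc[OF lim_1_over_n])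
  ultimately have "J u \<le> m + 0"
    by (rule LIMSEQ_le) (use X less_imp_le in blast)
  then have min: "J u \<le> J x" for x
    using m_le[of x] by simp
  have Re_eq: "Re (f v) = Re (cinner u v)" for v
  proof -
    define b where "b = Re (cinner u v) - Re (f v)"
    \<comment> \<open>The choice of \<open>t\<close> minimizes \<open>2 * t * b + t^2 * D\<close>,
      with value \<open>- b^2 / D\<close>; the added 1 keeps \<open>D\<close> positive when
      \<open>v = 0\<close>.\<close>
    define D where "D = (norm v)\<^sup>2 + 1"
    define t where "t = - b / D"
    have pos: "D > 0"
      by (simp add: D_def add_nonneg_pos)
    have "J (u + of_real t *\<^sub>C v) = J u + 2 * t * b + t\<^sup>2 * (norm v)\<^sup>2"
      by (simp add: J_def b_def norm_add_square add scale cinner_scaleC_right norm_scaleC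
          power_mult_distrib algebra_simps)
    then have "0 \<le> 2 * t * b + t\<^sup>2 * (norm v)\<^sup>2"
      using min[of "u + of_real t *\<^sub>C v"] by simp
    also have "\<dots> \<le> 2 * t * b + t\<^sup>2 * D"
      by (simp add: D_def algebra_simps)
    also have "\<dots> = - b\<^sup>2 / D"
      using pos by (simp add: t_def power2_eq_square field_simps)
    finally have "b\<^sup>2 \<le> 0"
      using pos by (simp add: field_simps)
    then show ?thesis
      by (simp add: b_def)
  qed
  \<comment> \<open>Up to sign, the imaginary part at \<open>v\<close> is the real part at
    \<open>v\<close> multiplied by \<open>\<i>\<close>.\<close>
  have "f v = cinner u v" for v
    using Re_eq[of v] Re_eq[of "\<i> *\<^sub>C v"]
    by (simp add: complex_eq_iff scale cinner_scaleC_right)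
  then show ?thesis
    by (rule that)
qed

section \<open>Supporting functionals of nonnegative quadratic forms\<close>

text \<open>The deviation \<open>r\<close> from linearity is additive and vanishes at the integers,
  so it has period 1 and is bounded on the whole line. Since \<open>r (k * t) = k * r t\<close>, it
  must be 0.\<close>

lemma additive_locally_bounded_imp_linear:
  fixes g :: "real \<Rightarrow> real"
  assumes add: "\<And>s t. g (s + t) = g s + g t"
    and bound: "\<And>t. \<bar>t\<bar> \<le> 1 \<Longrightarrow> \<bar>g t\<bar> \<le> C"
  shows "g t = t * g 1"
proof -
  define r where "r t = g t - t * g 1" for t
  have radd: "r (s + t) = r s + r t" for s t
    by (simp add: r_def add algebra_simps)
  have r1: "r 1 = 0"
    by (simp add: r_def)
  have r0: "r 0 = 0"
    using radd[of 0 0] by simp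
  have rnat: "r (real k * t) = real k * r t" for k t
    by (induction k) (simp_all add: r0 radd algebra_simps)
  have rneg: "r (- t) = - r t" for t
    using radd[of t "- t"] r0 by simp
  have rint: "r (of_int i) = 0" for i
    using rnat[of "nat i" 1] rnat[of "nat (- i)" 1] rneg[of "of_int i"] r1
    by (cases "0 \<le> i") simp_all
  have rbound: "\<bar>r t\<bar> \<le> 2 * C" if "\<bar>t\<bar> \<le> 1" for t
  proof -
    have "\<bar>t * g 1\<bar> \<le> 1 * C"
      unfolding abs_mult using that bound[of 1] by (intro mult_mono) auto
    then show ?thesis
      using bound[OF that] by (simp add: r_def)
  qed
  have "r t = 0"
  proof (rule ccontr)
    assume "r t \<noteq> 0"
    then obtain k :: nat where k: "2 * C < real k * \<bar>r t\<bar>"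
      by (metis reals_Archimedean3 zero_less_abs_iff)
    have "real k * r t = r (frac (real k * t))"
      using radd[of "frac (real k * t)" "of_int \<lfloor>real k * t\<rfloor>"]
      by (simp add: frac_def rint rnat)
    moreover have "\<bar>r (frac (real k * t))\<bar> \<le> 2 * C"
      by (rule rbound) (simp add: frac_lt_1 less_imp_le)
    ultimately show False
      using k by (metis abs_mult abs_of_nat linorder_not_le)
  qed
  then show ?thesis
    by (simp add: r_def)
qed

text \<open>The functional is \<open>y \<mapsto> B(y, x) / sqrt(A(x))\<close>, where \<open>B\<close> is the sesquilinear form obtained by
  polarization as in the Jordan--von Neumann theorem.\<close>

lemma quadratic_form_supporting_functional:
  fixes A :: "'a::complex_vector \<Rightarrow> real"
  assumes nonneg: "\<And>x. 0 \<le> A x"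
    and parallelogram: "\<And>x y. A (x + y) + A (x - y) = 2 * A x + 2 * A y"
    and scale: "\<And>c x. A (c *\<^sub>C x) = (cmod c)\<^sup>2 * A x"
    and pos: "0 < A x"
  obtains f where "\<And>y z. f (y + z) = f y + f z" "\<And>c y. f (c *\<^sub>C y) = c * f y"
    "\<And>y. (cmod (f y))\<^sup>2 \<le> A y" "(cmod (f x))\<^sup>2 = A x"
proof -
  define B where "B y z = (A (y + z) - A (y - z)) / 4" for y z
  have A0: "A 0 = 0"
    using scale[of 0 0] by simp
  have Aneg: "A (- y) = A y" for y
    using scale[of "- 1" y] by (simp add: scaleC_minus_left scaleC_one)
  have Aswap: "A (y - z) = A (z - y)" for y z
    by (metis Aneg minus_diff_eq)
  have A2: "A (2 *\<^sub>C y) = 4 * A y" for y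
    by (simp add: scale)
  have twice: "2 *\<^sub>C y = y + y" for y :: 'a
    by (metis one_add_one scaleC_add_left scaleC_one)
  \<comment> \<open>Subtract the parallelogram laws for the pairs \<open>u + z\<close>,
    \<open>v + z\<close> and \<open>u - z\<close>, \<open>v - z\<close>; the terms
    \<open>A (u - v)\<close> cancel.\<close>
  have sumdouble: "B u z + B v z = B (u + v) (2 *\<^sub>C z) / 2" for u v z
  proof -
    have 1: "A (u + v + 2 *\<^sub>C z) + A (u - v) = 2 * A (u + z) + 2 * A (v + z)"
      using parallelogram[of "u + z" "v + z"] by (simp add: twice algebra_simps)
    have 2: "A (u + v - 2 *\<^sub>C z) + A (u - v) = 2 * A (u - z) + 2 * A (v - z)"
      using parallelogram[of "u - z" "v - z"] by (simp add: twice algebra_simps)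
    show ?thesis
      using 1 2 unfolding B_def by (simp add: field_simps)
  qed
  have B0: "B 0 z = 0" for z
    using Aneg by (simp add: B_def)
  \<comment> \<open>Taking \<open>u + v\<close> and \<open>0\<close> as the two vectors in
    \<open>sumdouble\<close> gives half the value of \<open>B\<close> at \<open>u + v\<close> and
    the doubled \<open>z\<close> as \<open>B (u + v) z\<close>.\<close>
  have Badd: "B (u + v) z = B u z + B v z" for u v z
    using sumdouble[of u z v] sumdouble[of "u + v" z 0] by (simp add: B0)
  have Bbound: "\<bar>B y z\<bar> \<le> A y + A z" for y z
    using parallelogram[of y z] nonneg[of "y + z"] nonneg[of "y - z"] nonneg[of y] nonneg[of z]
    by (simp add: B_def)
  have Bscale: "B (of_real t *\<^sub>C y) z = t * B y z" for t y z
  proof -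
    \<comment> \<open>The space carries no topology, so real homogeneity is obtained from additivity
      in \<open>t\<close> together with the bound \<open>A y + A z\<close> for
      \<open>\<bar>t\<bar> \<le> 1\<close>.\<close>
    have "B (of_real t *\<^sub>C y) z = t * B (of_real 1 *\<^sub>C y) z"
    proof (rule additive_locally_bounded_imp_linear)
      fix s t :: real
      show "B (of_real (s + t) *\<^sub>C y) z = B (of_real s *\<^sub>C y) z + B (of_real t *\<^sub>C y) z"
        by (simp add: scaleC_add_left Badd)
    next
      fix t :: real
      assume "\<bar>t\<bar> \<le> 1"
      then have "t\<^sup>2 * A y \<le> 1 * A y"
        by (intro mult_right_mono nonneg) (simp add: abs_square_le_1)
      then show "\<bar>B (of_real t *\<^sub>C y) z\<bar> \<le> A y + A z"
        using Bbound[of "of_real t *\<^sub>C y" z] by (simp add: scale)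
    qed
    then show ?thesis
      by (simp add: scaleC_one)
  qed
  have expand: "A (y + z) = A y + A z + 2 * B y z" for y z
    using parallelogram[of y z] by (simp add: B_def field_simps)
  have Bsym: "B y z = B z y" for y z
    by (simp add: B_def Aswap[of y z] add.commute)
  have CS: "(B y x)\<^sup>2 \<le> A y * A x" for y
  proof -
    \<comment> \<open>The minimizer of the form along the real line through \<open>y\<close> in
      direction \<open>x\<close>.\<close>
    define t where "t = - B y x / A x"
    have "0 \<le> A (y + of_real t *\<^sub>C x)"
      by (rule nonneg)
    also have "\<dots> = A y + t\<^sup>2 * A x + 2 * t * B y x"
      using Bscale[of t x y] by (simp add: expand scale Bsym)
    also have "\<dots> = A y - (B y x)\<^sup>2 / A x"
      using pos by (simp add: t_def power2_eq_square field_simps)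
    finally show ?thesis
      using pos by (simp add: field_simps)
  qed
  \<comment> \<open>\<open>B\<close> is only the real part of the sesquilinear form. The imaginary
    part of a complex linear functional at \<open>y\<close> is minus its real part at
    \<open>y\<close> multiplied by \<open>\<i>\<close>.\<close>
  define f where "f y = Complex (B y x) (- B (\<i> *\<^sub>C y) x) / of_real (sqrt (A x))" for y
  have fadd: "f (y + z) = f y + f z" for y z
    by (simp add: f_def Badd scaleC_add_right complex_eq_iff add_divide_distrib
        diff_divide_distrib flip: of_real_add)
  have split: "c *\<^sub>C y = of_real (Re c) *\<^sub>C y + of_real (Im c) *\<^sub>C \<i> *\<^sub>C y" for c and y :: 'a
    by (metis complex_eq mult.commute scaleC_add_left scaleC_scaleC)
  have fscale: "f (c *\<^sub>C y) = c * f y" for c y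
  proof -
    have "\<i> *\<^sub>C \<i> *\<^sub>C y = - y"
      by (simp add: scaleC_scaleC scaleC_minus_left scaleC_one)
    moreover have "B (- y) x = - B y x"
      using Bscale[of "- 1" y x] by (simp add: scaleC_minus_left scaleC_one)
    moreover have "\<i> *\<^sub>C c *\<^sub>C y = of_real (Re c) *\<^sub>C \<i> *\<^sub>C y + of_real (Im c) *\<^sub>C \<i> *\<^sub>C \<i> *\<^sub>C y"
      by (metis split scaleC_add_right scaleC_scaleC mult.commute)
    ultimately have "B (\<i> *\<^sub>C c *\<^sub>C y) x = Re c * B (\<i> *\<^sub>C y) x - Im c * B y x"
      by (simp add: Badd Bscale)
    moreover have "B (c *\<^sub>C y) x = Re c * B y x + Im c * B (\<i> *\<^sub>C y) x"
      by (subst split) (simp add: Badd Bscale)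
    ultimately have "Complex (B (c *\<^sub>C y) x) (- B (\<i> *\<^sub>C c *\<^sub>C y) x)
        = c * Complex (B y x) (- B (\<i> *\<^sub>C y) x)"
      by (simp add: complex_eq_iff)
    then show ?thesis
      by (simp add: f_def)
  qed
  have fle: "(cmod (f y))\<^sup>2 \<le> A y" for y
  proof -
    \<comment> \<open>After rotation the value of \<open>f\<close> is real, hence given by
      \<open>B\<close> alone, and \<open>CS\<close> applies.\<close>
    obtain c where c: "cmod c = 1" "c * f y = of_real (cmod (f y))"
      by (rule unit_rotation)
    then have "cmod (f y) = Re (f (c *\<^sub>C y))"
      by (simp add: fscale)
    also have "\<dots> = B (c *\<^sub>C y) x / sqrt (A x)"
      by (simp add: f_def)
    finally have "(cmod (f y))\<^sup>2 = (B (c *\<^sub>C y) x)\<^sup>2 / A x"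
      using pos by (simp add: power_divide)
    then show ?thesis
      using CS[of "c *\<^sub>C y"] pos c(1) by (simp add: scale divide_le_eq)
  qed
  have "B x x = A x"
    using A2[of x] by (simp add: B_def A0 flip: twice)
  moreover have "B (\<i> *\<^sub>C x) x = 0"
  proof -
    \<comment> \<open>The two values agree because \<open>\<i> + 1\<close> and
      \<open>\<i> - 1\<close> have the same modulus.\<close>
    have "A (\<i> *\<^sub>C x + x) = A ((\<i> + 1) *\<^sub>C x)" "A (\<i> *\<^sub>C x - x) = A ((\<i> - 1) *\<^sub>C x)"
      by (simp_all add: scaleC_add_left scaleC_one diff_conv_add_uminus[of \<i>] scaleC_minus_left
          del: add_uminus_conv_diff)
        (simp add: scaleC_minus_left scaleC_one)?
    then show ?thesis
      by (simp add: B_def scale cmod_power2)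
  qed
  ultimately have "(cmod (f x))\<^sup>2 = A x"
    using pos by (simp add: f_def norm_divide power_divide complex_of_real_def[symmetric]
        power2_eq_square)
  with fadd fscale fle show ?thesis
    by (rule that)
qed

subsection \<open>Block Toeplitz forms and their Schur complements\<close>

text \<open>Taking the real part keeps the form real for arbitrary coefficients, so that the scaling
  and parallelogram laws are identities of real numbers.\<close>

definition toeplitz_form ::
    "(int \<Rightarrow> 'h::chilbert_space \<Rightarrow>\<^sub>C\<^sub>L 'h) \<Rightarrow> nat \<Rightarrow> (nat \<Rightarrow> 'h) \<Rightarrow> real"
  where "toeplitz_form \<tau> N p =
    Re (\<Sum>j<N. \<Sum>k<N. cinner (p j) (cblinfun_apply (\<tau> (int k - int j)) (p k)))"

text \<open>The infimum over all extensions of the first \<open>m\<close> entries is the Schur complement of the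
  infinite block Toeplitz matrix supported on its leading \<open>m \<times> m\<close> block.\<close>

definition schur_form ::
    "(int \<Rightarrow> 'h::chilbert_space \<Rightarrow>\<^sub>C\<^sub>L 'h) \<Rightarrow> nat \<Rightarrow> (nat \<Rightarrow> 'h) \<Rightarrow> real"
  where "schur_form \<tau> m x = Inf {toeplitz_form \<tau> N p | N p. m \<le> N \<and> (\<forall>k<m. p k = x k)}"

text \<open>Orthogonality of characters: for \<open>a \<noteq> 0\<close> the number
  \<open>\<zeta> powi a\<close> is an \<open>M\<close>-th root of unity other than 1, because
  \<open>M\<close> cannot divide \<open>a\<close>, and the geometric sum vanishes.\<close>

lemma sum_roots_of_unity_powi:
  fixes a :: int
  assumes M: "0 < M" and a: "\<bar>a\<bar> < int M"
  defines "\<zeta> \<equiv> cis (2 * pi / real M)"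
  shows "(\<Sum>s<M. (\<zeta> ^ s) powi a) = (if a = 0 then of_nat M else 0)"
proof (cases "a = 0")
  case True
  then show ?thesis by simp
next
  case False
  define u where "u = \<zeta> powi a"
  have u: "u = cis (2 * pi * of_int a / real M)"
    by (simp add: u_def \<zeta>_def cis_power_int mult.commute)
  have "u ^ M = 1"
  proof -
    have "u ^ M = cis (2 * pi * of_int a)"
      using M by (simp add: u Complex.DeMoivre)
    then show ?thesis
      by (simp add: cis_multiple_2pi)
  qed
  moreover have "u \<noteq> 1"
  proof
    assume "u = 1"
    then have "cos (2 * pi * of_int a / real M) = 1"
      by (metis u cis.simps(1) one_complex.simps(1))
    then obtain k where "2 * pi * of_int a / real M = of_int k * 2 * pi"
      by (auto simp: cos_one_2pi_int)
    then have "real_of_int a = of_int (k * int M)"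
      using M by (simp add: field_simps)
    then have "a = k * int M"
      using of_int_eq_iff by blast
    then have "int M dvd a"
      by simp
    with a False show False
      using zdvd_not_zless[of "\<bar>a\<bar>" "int M"] by simp
  qed
  moreover have "(\<zeta> ^ s) powi a = u ^ s" for s
    unfolding u_def by (metis power_int_mult mult.commute power_int_of_nat)
  ultimately show ?thesis
    using False by (simp add: geometric_sum)
qed

text \<open>Averaging the forms \<open>cinner (P z) (F z (P z))\<close> over the \<open>M\<close>-th
  roots of unity, a discrete Fourier transform in place of an integral over the circle, singles out
  the coefficients \<open>\<tau> (k - j)\<close>.\<close>

lemma toeplitz_form_nonneg:
  fixes \<tau> :: "int \<Rightarrow> 'h::chilbert_space \<Rightarrow>\<^sub>C\<^sub>L 'h"
  assumes supp: "\<And>l. int d < \<bar>l\<bar> \<Longrightarrow> \<tau> l = 0"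
    and pos: "\<And>z x. z \<in> unit_circle \<Longrightarrow>
      0 \<le> Re (cinner x (cblinfun_apply (\<Sum>l=-int d..int d. (z powi l) *\<^sub>C \<tau> l) x))"
  shows "0 \<le> toeplitz_form \<tau> N p"
proof -
  \<comment> \<open>Every exponent \<open>j - k + l\<close> has absolute value at most
    \<open>N - 1 + d < M\<close>, so no nonzero exponent survives the averaging.\<close>
  define M where "M = N + d + 1"
  define \<zeta> where "\<zeta> = cis (2 * pi / real M)"
  \<comment> \<open>With negative exponents the term for \<open>j\<close>, \<open>k\<close>,
    \<open>l\<close> carries \<open>z powi (j - k + l)\<close>, whose exponent is 0 exactly for
    \<open>l = k - j\<close>.\<close>
  define P where "P z = (\<Sum>k<N. (z powi (- int k)) *\<^sub>C p k)" for z
  define c where "c j k l = cinner (p j) (cblinfun_apply (\<tau> l) (p k))" for j k l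
  let ?F = "\<lambda>z. \<Sum>l=-int d..int d. (z powi l) *\<^sub>C \<tau> l"
  have unit: "\<zeta> ^ s \<in> unit_circle" for s
    by (simp add: \<zeta>_def norm_power)
  have expand: "cinner (P z) (cblinfun_apply (?F z) (P z))
      = (\<Sum>j<N. \<Sum>k<N. \<Sum>l=-int d..int d. c j k l * z powi (int j - int k + l))"
    if z: "z \<in> unit_circle" for z
  proof -
    have "z \<noteq> 0"
      using z by auto
    have conj: "cnj (z powi (- int j)) = z powi int j" for j
      by (simp add: cnj_unit_circle[OF z] power_int_minus power_int_inverse flip: power_int_of_nat)
    have "cinner (P z) (cblinfun_apply (?F z) (P z)) = (\<Sum>j<N. cinner ((z powi (- int j)) *\<^sub>C p j)
        (\<Sum>k<N. (z powi (- int k)) *\<^sub>C (\<Sum>l=-int d..int d. (z powi l) *\<^sub>C cblinfun_apply (\<tau> l) (p k))))"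
      unfolding P_def
      by (simp only: cinner_sum_left cblinfun_apply_sum_left cblinfun_apply_sum_right
          scaleC_cblinfun.rep_eq cblinfun_apply_scaleC_right)
    also have "\<dots> = (\<Sum>j<N. \<Sum>k<N. \<Sum>l=-int d..int d.
        z powi (- int k) * (z powi l * (z powi int j * c j k l)))"
      by (simp only: cinner_sum_right cinner_scaleC_left cinner_scaleC_right conj sum_distrib_left c_def)
    also have "\<dots> = (\<Sum>j<N. \<Sum>k<N. \<Sum>l=-int d..int d. c j k l * z powi (int j - int k + l))"
      using \<open>z \<noteq> 0\<close> by (simp add: power_int_add power_int_diff power_int_minus divide_inverse mult_ac)
    finally show ?thesis .
  qed
  have collapse: "(\<Sum>l=-int d..int d. c j k l * (\<Sum>s<M. (\<zeta> ^ s) powi (int j - int k + l)))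
      = of_nat M * c j k (int k - int j)" if "j < N" "k < N" for j k
  proof -
    have "(\<Sum>l=-int d..int d. c j k l * (\<Sum>s<M. (\<zeta> ^ s) powi (int j - int k + l)))
        = (\<Sum>l=-int d..int d. if l = int k - int j then of_nat M * c j k l else 0)"
    proof (rule sum.cong[OF refl])
      fix l assume "l \<in> {-int d..int d}"
      then have "\<bar>int j - int k + l\<bar> < int M"
        using that by (auto simp: M_def)
      moreover have "0 < M"
        by (simp add: M_def)
      ultimately show "c j k l * (\<Sum>s<M. (\<zeta> ^ s) powi (int j - int k + l))
          = (if l = int k - int j then of_nat M * c j k l else 0)"
        unfolding \<zeta>_def by (subst sum_roots_of_unity_powi) auto
    qed
    \<comment> \<open>If \<open>k - j\<close> lies outside the range of summation, its coefficient
      vanishes by \<open>supp\<close>.\<close>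
    also have "\<dots> = of_nat M * c j k (int k - int j)"
      using supp[of "int k - int j"] by (auto simp: c_def zero_cblinfun.rep_eq)
    finally show ?thesis .
  qed
  have "0 \<le> Re (\<Sum>s<M. cinner (P (\<zeta> ^ s)) (cblinfun_apply (?F (\<zeta> ^ s)) (P (\<zeta> ^ s))))"
    unfolding Re_sum by (intro sum_nonneg pos unit)
  also have "(\<Sum>s<M. cinner (P (\<zeta> ^ s)) (cblinfun_apply (?F (\<zeta> ^ s)) (P (\<zeta> ^ s))))
      = (\<Sum>s<M. \<Sum>j<N. \<Sum>k<N. \<Sum>l=-int d..int d. c j k l * (\<zeta> ^ s) powi (int j - int k + l))"
    by (intro sum.cong refl expand unit)
  also have "\<dots> = (\<Sum>j<N. \<Sum>k<N. \<Sum>l=-int d..int d. \<Sum>s<M. c j k l * (\<zeta> ^ s) powi (int j - int k + l))"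
    by (simp only: sum.swap[where A = "{..<M}"])
  also have "\<dots> = (\<Sum>j<N. \<Sum>k<N. of_nat M * c j k (int k - int j))"
    by (intro sum.cong refl) (simp add: collapse flip: sum_distrib_left)
  also have "Re \<dots> = real M * toeplitz_form \<tau> N p"
    by (simp add: toeplitz_form_def c_def sum_distrib_left)
  finally show ?thesis
    by (simp add: M_def zero_le_mult_iff)
qed

text \<open>Zero padding brings forms of different lengths to a common one.\<close>

lemma toeplitz_form_extend:
  assumes "N \<le> N'"
  shows "toeplitz_form \<tau> N' (\<lambda>k. if k < N then p k else 0) = toeplitz_form \<tau> N p"
proof -
  have "{..<N} \<subseteq> {..<N'}"
    using assms by auto
  then show ?thesis
    unfolding toeplitz_form_def
    by (intro arg_cong[where f = Re] sum.mono_neutral_cong_right) (auto intro!: sum.mono_neutral_cong_right)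
qed

lemma toeplitz_form_scaleC:
  "toeplitz_form \<tau> N (\<lambda>k. a *\<^sub>C p k) = (cmod a)\<^sup>2 * toeplitz_form \<tau> N p"
proof -
  have "(\<Sum>j<N. \<Sum>k<N. cinner (a *\<^sub>C p j) (cblinfun_apply (\<tau> (int k - int j)) (a *\<^sub>C p k)))
      = of_real ((cmod a)\<^sup>2) * (\<Sum>j<N. \<Sum>k<N. cinner (p j) (cblinfun_apply (\<tau> (int k - int j)) (p k)))"
    by (simp only: complex_norm_square)
      (simp add: cblinfun_apply_scaleC_right cinner_scaleC_left cinner_scaleC_right
        sum_distrib_left mult_ac)
  then show ?thesis
    by (simp add: toeplitz_form_def)
qed

lemma toeplitz_form_parallelogram:
  "toeplitz_form \<tau> N (\<lambda>k. p k + q k) + toeplitz_form \<tau> N (\<lambda>k. p k - q k)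
    = 2 * toeplitz_form \<tau> N p + 2 * toeplitz_form \<tau> N q"
  unfolding toeplitz_form_def
  by (simp add: cblinfun_apply_add_right cblinfun_apply_diff_right cinner_add_left cinner_add_right
      cinner_diff_left cinner_diff_right sum.distrib sum_subtractf)

text \<open>Deleting row and column 0 leaves the differences \<open>k - j\<close> unchanged, and the
  band width cuts the deleted row and column at \<open>d\<close>.\<close>

lemma toeplitz_form_Suc:
  fixes \<tau> :: "int \<Rightarrow> 'h::chilbert_space \<Rightarrow>\<^sub>C\<^sub>L 'h"
  assumes supp: "\<And>l. int d < \<bar>l\<bar> \<Longrightarrow> \<tau> l = 0" and N: "d \<le> N"
  shows "toeplitz_form \<tau> (Suc N) p = toeplitz_form \<tau> N (\<lambda>k. p (Suc k)) +
    Re (cinner (p 0) (cblinfun_apply (\<tau> 0) (p 0)) +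
      (\<Sum>k=1..d. cinner (p 0) (cblinfun_apply (\<tau> (int k)) (p k)) +
        cinner (p k) (cblinfun_apply (\<tau> (- int k)) (p 0))))"
proof -
  define c where "c j k = cinner (p j) (cblinfun_apply (\<tau> (int k - int j)) (p k))" for j k
  have restrict: "(\<Sum>k<N. g (Suc k)) = (\<Sum>k=1..d. g k)"
    if "\<And>k. d < k \<Longrightarrow> g k = 0" for g :: "nat \<Rightarrow> complex"
  proof -
    have "(\<Sum>k<N. g (Suc k)) = sum g {1..N}"
      by (rule sum.reindex_bij_witness[of _ "\<lambda>k. k - 1" Suc]) auto
    also have "\<dots> = sum g {1..d}"
      using N that by (intro sum.mono_neutral_right) auto
    finally show ?thesis .
  qed
  have "(\<Sum>j<Suc N. \<Sum>k<Suc N. c j k)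
      = c 0 0 + ((\<Sum>k<N. c 0 (Suc k)) + (\<Sum>j<N. c (Suc j) 0)) + (\<Sum>j<N. \<Sum>k<N. c (Suc j) (Suc k))"
    by (simp only: sum.lessThan_Suc_shift sum.distrib add_ac)
  also have "(\<Sum>k<N. c 0 (Suc k)) = (\<Sum>k=1..d. c 0 k)"
    by (rule restrict) (simp add: c_def supp zero_cblinfun.rep_eq)
  also have "(\<Sum>j<N. c (Suc j) 0) = (\<Sum>j=1..d. c j 0)"
    by (rule restrict) (simp add: c_def supp zero_cblinfun.rep_eq)
  finally show ?thesis
    by (simp add: toeplitz_form_def c_def sum.distrib)
qed

section \<open>The Schur complement as a nonnegative quadratic form\<close>

context
  fixes \<tau> :: "int \<Rightarrow> 'h::chilbert_space \<Rightarrow>\<^sub>C\<^sub>L 'h"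
  assumes nonneg: "\<And>N p. 0 \<le> toeplitz_form \<tau> N p"
begin

text \<open>Nonnegativity bounds the set of values below, so that \<open>Inf\<close> is a true
  infimum.\<close>

lemma schur_form_le:
  assumes "m \<le> N" "\<And>k. k < m \<Longrightarrow> p k = x k"
  shows "schur_form \<tau> m x \<le> toeplitz_form \<tau> N p"
  unfolding schur_form_def
  using assms nonneg by (intro cInf_lower bdd_belowI[of _ 0]) auto

text \<open>The set of values is nonempty, since \<open>x\<close> is an extension of itself with
  \<open>N = m\<close>.\<close>

lemma schur_form_greatest:
  assumes "\<And>N p. \<lbrakk>m \<le> N; \<And>k. k < m \<Longrightarrow> p k = x k\<rbrakk> \<Longrightarrow> b \<le> toeplitz_form \<tau> N p"
  shows "b \<le> schur_form \<tau> m x"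
  unfolding schur_form_def using assms by (intro cInf_greatest) auto

lemma schur_form_nonneg: "0 \<le> schur_form \<tau> m x"
  by (rule schur_form_greatest) (rule nonneg)

text \<open>Prescribing more entries leaves fewer competitors for the infimum.\<close>

lemma schur_form_mono:
  assumes "m \<le> m'"
  shows "schur_form \<tau> m x \<le> schur_form \<tau> m' x"
  using assms by (intro schur_form_greatest schur_form_le) auto

text \<open>Scaling carries extensions to extensions, which gives one inequality for
  \<open>a \<noteq> 0\<close>; applied to \<open>inverse a\<close> it gives the other.\<close>

lemma schur_form_scaleC: "schur_form \<tau> m (\<lambda>k. a *\<^sub>C x k) = (cmod a)\<^sup>2 * schur_form \<tau> m x"
proof -
  have le: "schur_form \<tau> m (\<lambda>k. a *\<^sub>C x k) \<le> (cmod a)\<^sup>2 * schur_form \<tau> m x"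
    if a: "a \<noteq> 0" for a and x :: "nat \<Rightarrow> 'h"
  proof -
    have "schur_form \<tau> m (\<lambda>k. a *\<^sub>C x k) / (cmod a)\<^sup>2 \<le> schur_form \<tau> m x"
    proof (rule schur_form_greatest)
      fix N p
      assume "m \<le> N" "\<And>k. k < m \<Longrightarrow> p k = x k"
      then have "schur_form \<tau> m (\<lambda>k. a *\<^sub>C x k) \<le> toeplitz_form \<tau> N (\<lambda>k. a *\<^sub>C p k)"
        by (intro schur_form_le) auto
      then show "schur_form \<tau> m (\<lambda>k. a *\<^sub>C x k) / (cmod a)\<^sup>2 \<le> toeplitz_form \<tau> N p"
        using a by (simp add: toeplitz_form_scaleC field_simps)
    qed
    then show ?thesis
      using a by (simp add: field_simps)
  qed
  show ?thesis
  proof (cases "a = 0")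
    case True
    have "schur_form \<tau> m (\<lambda>k. 0) \<le> toeplitz_form \<tau> m (\<lambda>k. 0)"
      by (rule schur_form_le) auto
    then show ?thesis
      using True schur_form_nonneg[of m "\<lambda>k. 0"] by (simp add: toeplitz_form_def)
  next
    case False
    have "schur_form \<tau> m (\<lambda>k. inverse a *\<^sub>C a *\<^sub>C x k)
        \<le> (cmod (inverse a))\<^sup>2 * schur_form \<tau> m (\<lambda>k. a *\<^sub>C x k)"
      using False by (intro le) auto
    then have "(cmod a)\<^sup>2 * schur_form \<tau> m x \<le> schur_form \<tau> m (\<lambda>k. a *\<^sub>C x k)"
      using False by (simp add: scaleC_scaleC scaleC_one norm_divide power_divide field_simps)
    with le[OF False] show ?thesis
      by (rule antisym)
  qed
qed

text \<open>Extensions of \<open>x\<close> and \<open>y\<close> yield extensions of their sum and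
  difference, whence one inequality. Inserting the sum and difference into it gives the
  converse.\<close>

lemma schur_form_parallelogram:
  "schur_form \<tau> m (\<lambda>k. x k + y k) + schur_form \<tau> m (\<lambda>k. x k - y k)
    = 2 * schur_form \<tau> m x + 2 * schur_form \<tau> m y"
proof -
  have le: "schur_form \<tau> m (\<lambda>k. x k + y k) + schur_form \<tau> m (\<lambda>k. x k - y k)
    \<le> 2 * schur_form \<tau> m x + 2 * schur_form \<tau> m y" (is "?L x y \<le> _") for x y :: "nat \<Rightarrow> 'h"
  proof -
    have both: "?L x y \<le> 2 * toeplitz_form \<tau> N p + 2 * toeplitz_form \<tau> N' q"
      if N: "m \<le> N" "\<And>k. k < m \<Longrightarrow> p k = x k" and N': "m \<le> N'" "\<And>k. k < m \<Longrightarrow> q k = y k"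
      for N N' p q
    proof -
      define p' where "p' k = (if k < N then p k else 0)" for k
      define q' where "q' k = (if k < N' then q k else 0)" for k
      let ?M = "max N N'"
      have "?L x y \<le> toeplitz_form \<tau> ?M (\<lambda>k. p' k + q' k) + toeplitz_form \<tau> ?M (\<lambda>k. p' k - q' k)"
        using N N' by (intro add_mono schur_form_le) (auto simp: p'_def q'_def)
      also have "\<dots> = 2 * toeplitz_form \<tau> ?M p' + 2 * toeplitz_form \<tau> ?M q'"
        by (rule toeplitz_form_parallelogram)
      also have "\<dots> = 2 * toeplitz_form \<tau> N p + 2 * toeplitz_form \<tau> N' q"
        unfolding p'_def q'_def by (simp add: toeplitz_form_extend)
      finally show ?thesis .
    qed
    \<comment> \<open>The infima over the extensions of \<open>x\<close> and of \<open>y\<close> are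
      taken one after the other.\<close>
    have "(?L x y - 2 * schur_form \<tau> m y) / 2 \<le> schur_form \<tau> m x"
    proof (rule schur_form_greatest)
      fix N p
      assume p: "m \<le> N" "\<And>k. k < m \<Longrightarrow> p k = x k"
      have "(?L x y - 2 * toeplitz_form \<tau> N p) / 2 \<le> schur_form \<tau> m y"
      proof (rule schur_form_greatest)
        fix N' q
        assume "m \<le> N'" "\<And>k. k < m \<Longrightarrow> q k = y k"
        then show "(?L x y - 2 * toeplitz_form \<tau> N p) / 2 \<le> toeplitz_form \<tau> N' q"
          using both[OF p] by (simp add: field_simps)
      qed
      then show "(?L x y - 2 * schur_form \<tau> m y) / 2 \<le> toeplitz_form \<tau> N p"
        by (simp add: field_simps)
    qed
    then show ?thesis
      by (simp add: field_simps)
  qed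
  have double: "schur_form \<tau> m (\<lambda>k. x k + x k) = 4 * schur_form \<tau> m x" for x :: "nat \<Rightarrow> 'h"
    using schur_form_scaleC[of m 2 x] scaleC_add_left[of 1 1 "x _"] by (simp add: scaleC_one)
  show ?thesis
    using le[of x y] le[of "\<lambda>k. x k + y k" "\<lambda>k. x k - y k"] double[of x] double[of y]
    by (simp add: algebra_simps)
qed

text \<open>All but the first row and column of an infinite Toeplitz matrix form the same matrix again,
  and \<open>\<tau>\<close> vanishes beyond \<open>d\<close>, so the first entry interacts only with the prescribed ones.\<close>

lemma schur_form_Suc:
  assumes supp: "\<And>l. int d < \<bar>l\<bar> \<Longrightarrow> \<tau> l = 0"
  shows "schur_form \<tau> (Suc d) x = schur_form \<tau> d (\<lambda>k. x (Suc k)) +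
    Re (cinner (x 0) (cblinfun_apply (\<tau> 0) (x 0)) +
      (\<Sum>k=1..d. cinner (x 0) (cblinfun_apply (\<tau> (int k)) (x k)) +
        cinner (x k) (cblinfun_apply (\<tau> (- int k)) (x 0))))"
    (is "_ = _ + ?R x")
proof (rule antisym)
  have "schur_form \<tau> (Suc d) x - ?R x \<le> schur_form \<tau> d (\<lambda>k. x (Suc k))"
  proof (rule schur_form_greatest)
    fix N p
    assume N: "d \<le> N" and p: "\<And>k. k < d \<Longrightarrow> p k = x (Suc k)"
    \<comment> \<open>Prepending \<open>x 0\<close> turns an extension of the shifted vector into an
      extension of \<open>x\<close>.\<close>
    define q where "q = case_nat (x 0) p"
    have q: "q k = x k" if "k < Suc d" for k
      using that p by (cases k) (auto simp: q_def)
    have "schur_form \<tau> (Suc d) x \<le> toeplitz_form \<tau> (Suc N) q"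
      using N q by (intro schur_form_le) auto
    also have "\<dots> = toeplitz_form \<tau> N (\<lambda>k. q (Suc k)) + ?R q"
      by (rule toeplitz_form_Suc[OF supp N])
    also have "?R q = ?R x"
      by (simp add: q)
    finally show "schur_form \<tau> (Suc d) x - ?R x \<le> toeplitz_form \<tau> N p"
      by (simp add: q_def)
  qed
  then show "schur_form \<tau> (Suc d) x \<le> schur_form \<tau> d (\<lambda>k. x (Suc k)) + ?R x"
    by simp
  show "schur_form \<tau> d (\<lambda>k. x (Suc k)) + ?R x \<le> schur_form \<tau> (Suc d) x"
  proof (rule schur_form_greatest)
    fix N p
    assume "Suc d \<le> N" and p: "\<And>k. k < Suc d \<Longrightarrow> p k = x k"
    then obtain N' where N': "N = Suc N'" "d \<le> N'"
      by (metis Suc_le_D Suc_le_mono)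
    have "schur_form \<tau> d (\<lambda>k. x (Suc k)) \<le> toeplitz_form \<tau> N' (\<lambda>k. p (Suc k))"
      using N' p by (intro schur_form_le) auto
    moreover have "toeplitz_form \<tau> N p = toeplitz_form \<tau> N' (\<lambda>k. p (Suc k)) + ?R p"
      unfolding N' by (rule toeplitz_form_Suc[OF supp N'(2)])
    moreover have "?R p = ?R x"
      by (simp add: p)
    ultimately show "schur_form \<tau> d (\<lambda>k. x (Suc k)) + ?R x \<le> toeplitz_form \<tau> N p"
      by simp
  qed
qed

end

lemma schur_form_cong:
  "(\<And>k. k < m \<Longrightarrow> x k = y k) \<Longrightarrow> schur_form \<tau> m x = schur_form \<tau> m y"
  unfolding schur_form_def by metis

text \<open>Serves to bound the Schur complement on vectors with a single nonzero entry.\<close>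

lemma toeplitz_form_single:
  assumes "i < N"
  shows "toeplitz_form \<tau> N (\<lambda>k. if k = i then h else 0) = Re (cinner h (cblinfun_apply (\<tau> 0) h))"
proof -
  let ?p = "\<lambda>k. if k = i then h else 0"
  have "(\<Sum>j<N. \<Sum>k<N. cinner (?p j) (cblinfun_apply (\<tau> (int k - int j)) (?p k)))
      = (\<Sum>j<N. \<Sum>k<N. if k = i then if j = i then cinner h (cblinfun_apply (\<tau> 0) h) else 0 else 0)"
    by (intro sum.cong refl) auto
  then show ?thesis
    using assms by (simp add: toeplitz_form_def)
qed

lemma sum_symmetric_interval:
  fixes g :: "int \<Rightarrow> 'a::comm_monoid_add"
  shows "(\<Sum>l=-int d..int d. g l) = g 0 + (\<Sum>k=1..d. g (int k) + g (- int k))"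
proof (induction d)
  case (Suc d)
  have "{-int (Suc d)..int (Suc d)} = insert (int (Suc d)) (insert (- int (Suc d)) {-int d..int d})"
    by auto
  then show ?case
    by (simp add: Suc.IH add_ac)
qed simp

text \<open>Shifting a geometric vector multiplies it by \<open>z\<close>, which has modulus 1 and
  so leaves the Schur form unchanged. Only row and column 0 remain, and they assemble to the
  trigonometric polynomial at \<open>z\<close>.\<close>

lemma schur_form_geometric:
  fixes \<tau> :: "int \<Rightarrow> 'h::chilbert_space \<Rightarrow>\<^sub>C\<^sub>L 'h"
  assumes nonneg: "\<And>N p. 0 \<le> toeplitz_form \<tau> N p"
    and supp: "\<And>l. int d < \<bar>l\<bar> \<Longrightarrow> \<tau> l = 0" and z: "z \<in> unit_circle"
    and x: "\<And>k. k \<le> d \<Longrightarrow> x k = z ^ k *\<^sub>C h"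
  shows "schur_form \<tau> (Suc d) x - schur_form \<tau> d x
    = Re (cinner h (cblinfun_apply (\<Sum>l=-int d..int d. (z powi l) *\<^sub>C \<tau> l) h))"
proof -
  have "schur_form \<tau> d (\<lambda>k. x (Suc k)) = schur_form \<tau> d (\<lambda>k. z *\<^sub>C x k)"
    by (rule schur_form_cong) (simp add: x scaleC_scaleC)
  also have "\<dots> = schur_form \<tau> d x"
    using z by (simp add: schur_form_scaleC[OF nonneg])
  finally have "schur_form \<tau> (Suc d) x - schur_form \<tau> d x =
    Re (cinner (x 0) (cblinfun_apply (\<tau> 0) (x 0)) +
      (\<Sum>k=1..d. cinner (x 0) (cblinfun_apply (\<tau> (int k)) (x k)) +
        cinner (x k) (cblinfun_apply (\<tau> (- int k)) (x 0))))"
    using schur_form_Suc[OF nonneg supp, where x = x] by simp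
  also have "cinner (x 0) (cblinfun_apply (\<tau> 0) (x 0)) +
      (\<Sum>k=1..d. cinner (x 0) (cblinfun_apply (\<tau> (int k)) (x k)) +
        cinner (x k) (cblinfun_apply (\<tau> (- int k)) (x 0)))
    = cinner h (cblinfun_apply (\<tau> 0) h) +
      (\<Sum>k=1..d. z powi (int k) * cinner h (cblinfun_apply (\<tau> (int k)) h) +
        z powi (- int k) * cinner h (cblinfun_apply (\<tau> (- int k)) h))"
  proof -
    have "cnj z ^ k = z powi (- int k)" for k
      by (simp add: cnj_unit_circle[OF z] power_int_minus power_inverse)
    then show ?thesis
      by (intro arg_cong2[where f = "(+)"] sum.cong)
        (simp_all add: x scaleC_one cblinfun_apply_scaleC_right cinner_scaleC_left
          cinner_scaleC_right)
  qed
  also have "\<dots> = (\<Sum>l=-int d..int d. z powi l * cinner h (cblinfun_apply (\<tau> l) h))"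
    by (simp add: sum_symmetric_interval)
  also have "\<dots> = cinner h (cblinfun_apply (\<Sum>l=-int d..int d. (z powi l) *\<^sub>C \<tau> l) h)"
    by (simp add: cblinfun_apply_sum_left scaleC_cblinfun.rep_eq cinner_sum_right
        cinner_scaleC_right)
  finally show ?thesis .
qed

subsection \<open>Compressions of the Toeplitz matrix\<close>

lemma bij_betw_index_of: "bij_betw index_of (UNIV :: 'n::{finite,linorder} set) {..<CARD('n)}"
proof -
  have lt: "index_of i < index_of j" if "i < j" for i j :: 'n
    unfolding index_of_def using that by (intro psubset_card_mono) auto
  have inj: "inj (index_of :: 'n \<Rightarrow> nat)"
    by (rule injI) (metis lt less_irrefl linorder_less_linear)
  have "index_of i < CARD('n)" for i :: 'n
    unfolding index_of_def by (intro psubset_card_mono) auto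
  then have "range (index_of :: 'n \<Rightarrow> nat) = {..<CARD('n)}"
    using inj by (intro card_subset_eq) (auto simp: card_image)
  with inj show ?thesis
    by (simp add: bij_betw_def)
qed

section \<open>Operators of finite rank\<close>

lift_definition rank_one :: "'a::complex_inner \<Rightarrow> 'a \<Rightarrow> 'a \<Rightarrow>\<^sub>C\<^sub>L 'a"
  is "\<lambda>u v x. cinner v x *\<^sub>C u"
proof -
  fix u v :: 'a
  have "norm (cinner v x *\<^sub>C u) \<le> (norm v * norm u) * norm x" for x
    using mult_right_mono[OF cinner_Cauchy_Schwarz[of v x] norm_ge_zero[of u]]
    by (simp add: norm_scaleC mult_ac)
  then show "bounded_clinear (\<lambda>x. cinner v x *\<^sub>C u)"
    by (auto simp: bounded_clinear_def cinner_add_right cinner_scaleC_right scaleC_add_left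
        scaleC_scaleC)
qed

lift_definition row_operator :: "('n::finite \<Rightarrow> 'a::chilbert_space) \<Rightarrow> 'a \<Rightarrow>\<^sub>C\<^sub>L (complex ^ 'n)"
  is "\<lambda>W x. \<chi> k. cinner (W k) x"
proof -
  fix W :: "'n \<Rightarrow> 'a"
  have "norm (\<chi> k. cinner (W k) x) \<le> (\<Sum>k\<in>UNIV. norm (W k)) * norm x" for x
  proof -
    have "norm (\<chi> k. cinner (W k) x) \<le> (\<Sum>k\<in>UNIV. cmod (cinner (W k) x))"
      by (simp add: norm_vec_def L2_set_le_sum)
    also have "\<dots> \<le> (\<Sum>k\<in>UNIV. norm (W k) * norm x)"
      by (intro sum_mono cinner_Cauchy_Schwarz)
    finally show ?thesis
      by (simp add: sum_distrib_right)
  qed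
  then show "bounded_clinear (\<lambda>x. \<chi> k. cinner (W k) x)"
    by (auto simp: bounded_clinear_def cinner_add_right cinner_scaleC_right vec_eq_iff
        scaleC_vec_def scaleC_complex_def)
qed

text \<open>Written down explicitly so that the adjoint of \<open>row_operator W\<close> can be
  identified through its defining equation.\<close>

lift_definition column_operator :: "('n::finite \<Rightarrow> 'a::chilbert_space) \<Rightarrow> (complex ^ 'n) \<Rightarrow>\<^sub>C\<^sub>L 'a"
  is "\<lambda>W v. \<Sum>k\<in>UNIV. (v $ k) *\<^sub>C W k"
proof -
  fix W :: "'n \<Rightarrow> 'a"
  have "norm (\<Sum>k\<in>UNIV. (v $ k) *\<^sub>C W k) \<le> (\<Sum>k\<in>UNIV. norm (W k)) * norm v" for v
  proof -
    have "norm (\<Sum>k\<in>UNIV. (v $ k) *\<^sub>C W k) \<le> (\<Sum>k\<in>UNIV. norm ((v $ k) *\<^sub>C W k))"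
      by (rule norm_sum)
    also have "\<dots> \<le> (\<Sum>k\<in>UNIV. norm (W k) * norm v)"
      by (intro sum_mono) (simp add: norm_scaleC mult.commute[of "norm (W _)"] mult_right_mono Finite_Cartesian_Product.norm_nth_le)
    finally show ?thesis
      by (simp add: sum_distrib_right)
  qed
  then show "bounded_clinear (\<lambda>v. \<Sum>k\<in>UNIV. (v $ k) *\<^sub>C W k)"
    by (auto simp: bounded_clinear_def scaleC_add_left sum.distrib
        scaleC_vec_def scaleC_complex_def cblinfun_apply_sum_right
        scaleC_sum_right scaleC_scaleC[symmetric])
qed

lemma cadjoint_row_operator: "cadjoint (row_operator W) = column_operator W"
proof (rule cadjoint_eqI)
  show "cinner (cblinfun_apply (column_operator W) y) x = cinner y (cblinfun_apply (row_operator W) x)"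
    for x y
    by (simp add: row_operator.rep_eq column_operator.rep_eq cinner_vec_def cinner_complex_def
        cinner_sum_left cinner_scaleC_left)
qed

text \<open>Displays the powers of \<open>z\<close>, from which the coefficients and the quadratic
  form are read off.\<close>

lemma toeplitz_compression:
  fixes W :: "'n::{finite,linorder} \<Rightarrow> 'a::chilbert_space"
  shows "cadjoint (row_operator W) o\<^sub>C\<^sub>L cblinfun_of_matrix (toeplitz (inverse z)) o\<^sub>C\<^sub>L row_operator W
    = (\<Sum>k\<in>UNIV. \<Sum>j\<in>UNIV. (z powi (int (index_of j) - int (index_of k))) *\<^sub>C rank_one (W k) (W j))"
proof (rule cblinfun_eqI)
  have inv: "inverse z powi (int a - int b) = z powi (int b - int a)" for a b
    by (metis minus_diff_eq power_int_inverse power_int_minus)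
  show "cblinfun_apply (cadjoint (row_operator W) o\<^sub>C\<^sub>L cblinfun_of_matrix (toeplitz (inverse z)) o\<^sub>C\<^sub>L row_operator W) x
    = cblinfun_apply (\<Sum>k\<in>UNIV. \<Sum>j\<in>UNIV. (z powi (int (index_of j) - int (index_of k))) *\<^sub>C rank_one (W k) (W j)) x" for x
    by (simp add: cadjoint_row_operator cblinfun_compose.rep_eq column_operator.rep_eq
        row_operator.rep_eq cblinfun_of_matrix.rep_eq matrix_vector_mult_def toeplitz_def inv
        cblinfun_apply_sum_left scaleC_cblinfun.rep_eq rank_one.rep_eq scaleC_scaleC
        scaleC_sum_left)
qed

text \<open>On the circle the Toeplitz matrix at \<open>inverse z\<close> has rank one: its entry in
  row \<open>k\<close> and column \<open>j\<close> is \<open>cnj (z ^ k) * z ^ j\<close>. The form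
  is therefore a squared modulus, and compressions are positive.\<close>

lemma cinner_toeplitz_compression:
  fixes W :: "'n::{finite,linorder} \<Rightarrow> 'a::chilbert_space"
  assumes z: "z \<in> unit_circle"
  shows "cinner h (cblinfun_apply (cadjoint (row_operator W) o\<^sub>C\<^sub>L
      cblinfun_of_matrix (toeplitz (inverse z)) o\<^sub>C\<^sub>L row_operator W) h)
    = of_real ((cmod (\<Sum>j\<in>UNIV. z ^ index_of j * cinner (W j) h))\<^sup>2)"
proof -
  have nz: "z \<noteq> 0" "cnj z = inverse z"
    using z cnj_unit_circle by auto
  let ?g = "\<lambda>j. z ^ index_of j * cinner (W j) h"
  have "cinner h (cblinfun_apply (cadjoint (row_operator W) o\<^sub>C\<^sub>L
      cblinfun_of_matrix (toeplitz (inverse z)) o\<^sub>C\<^sub>L row_operator W) h)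
    = (\<Sum>k\<in>UNIV. \<Sum>j\<in>UNIV. (z powi (int (index_of j) - int (index_of k))) *
        (cinner (W j) h * cinner h (W k)))"
    unfolding toeplitz_compression
    by (simp only: cblinfun_apply_sum_left scaleC_cblinfun.rep_eq rank_one.rep_eq
        cinner_sum_right cinner_scaleC_right)
  also have "\<dots> = (\<Sum>k\<in>UNIV. \<Sum>j\<in>UNIV. cnj (?g k) * ?g j)"
  proof (intro sum.cong refl)
    fix k j :: 'n
    have "z powi (int (index_of j) - int (index_of k)) = z ^ index_of j * cnj z ^ index_of k"
      using nz by (simp add: power_int_diff divide_inverse power_inverse)
    moreover have "cinner h (W k) = cnj (cinner (W k) h)"
      by (rule cinner_commute)
    ultimately show "(z powi (int (index_of j) - int (index_of k))) *
        (cinner (W j) h * cinner h (W k)) = cnj (?g k) * ?g j"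
      by simp
  qed
  also have "\<dots> = cnj (\<Sum>j\<in>UNIV. ?g j) * (\<Sum>j\<in>UNIV. ?g j)"
    by (simp only: cnj_sum sum_product)
  finally show ?thesis
    by (simp only: complex_norm_square) (simp only: mult.commute)
qed

lemma toeplitz_compression_in_trig_polys:
  fixes W :: "'n::{finite,linorder} \<Rightarrow> 'a::chilbert_space"
  shows "(\<lambda>z. cadjoint (row_operator W) o\<^sub>C\<^sub>L cblinfun_of_matrix (toeplitz (inverse z)) o\<^sub>C\<^sub>L row_operator W)
    \<in> trig_polys CARD('n)"
proof -
  \<comment> \<open>Index pairs are grouped by their difference, which lies strictly between
    \<open>- CARD('n)\<close> and \<open>CARD('n)\<close>.\<close>
  define \<sigma> where "\<sigma> l = (\<Sum>k\<in>UNIV. \<Sum>j\<in>UNIV.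
    if l = int (index_of j) - int (index_of k) then rank_one (W k) (W j) else 0)" for l
  have lt: "index_of i < CARD('n)" for i :: 'n
    using bij_betw_index_of bij_betwE by blast
  have eq: "(\<Sum>l=-int CARD('n)+1..int CARD('n)-1. (z powi l) *\<^sub>C \<sigma> l)
    = (\<Sum>k\<in>UNIV. \<Sum>j\<in>UNIV. (z powi (int (index_of j) - int (index_of k))) *\<^sub>C rank_one (W k) (W j))"
    for z
  proof -
    let ?L = "{-int CARD('n)+1..int CARD('n)-1}"
    let ?t = "\<lambda>k j l. (z powi l) *\<^sub>C (if l = int (index_of j) - int (index_of k) then rank_one (W k) (W j) else 0)"
    have "(\<Sum>l\<in>?L. (z powi l) *\<^sub>C \<sigma> l) = (\<Sum>l\<in>?L. \<Sum>k\<in>UNIV. \<Sum>j\<in>UNIV. ?t k j l)"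
      by (simp only: \<sigma>_def scaleC_sum_right)
    also have "\<dots> = (\<Sum>k\<in>UNIV. \<Sum>j\<in>UNIV. \<Sum>l\<in>?L. ?t k j l)"
      by (simp only: sum.swap[where A = ?L])
    also have "\<dots> = (\<Sum>k\<in>UNIV. \<Sum>j\<in>UNIV. (z powi (int (index_of j) - int (index_of k))) *\<^sub>C rank_one (W k) (W j))"
    proof (intro sum.cong refl)
      fix k j :: 'n
      let ?i = "int (index_of j) - int (index_of k)"
      have "(\<Sum>l\<in>?L. ?t k j l) = (\<Sum>l\<in>?L. if l = ?i then (z powi l) *\<^sub>C rank_one (W k) (W j) else 0)"
        by (intro sum.cong refl) simp
      also have "\<dots> = (z powi ?i) *\<^sub>C rank_one (W k) (W j)"
        using lt[of k] lt[of j] by (subst sum.delta) auto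
      finally show "(\<Sum>l\<in>?L. ?t k j l) = (z powi ?i) *\<^sub>C rank_one (W k) (W j)" .
    qed
    finally show ?thesis .
  qed
  show ?thesis
    unfolding trig_polys_def toeplitz_compression
    by (intro CollectI exI[of _ \<sigma>] ballI) (rule eq[symmetric])
qed

lemma trig_polys_diff:
  assumes "F \<in> trig_polys n" "G \<in> trig_polys n"
  shows "(\<lambda>z. F z - G z) \<in> trig_polys n"
proof -
  obtain \<sigma> \<tau> where
    "\<forall>z\<in>unit_circle. F z = (\<Sum>l=-int n+1..int n-1. (z powi l) *\<^sub>C \<sigma> l)"
    "\<forall>z\<in>unit_circle. G z = (\<Sum>l=-int n+1..int n-1. (z powi l) *\<^sub>C \<tau> l)"
    using assms unfolding trig_polys_def by blast
  then have "\<forall>z\<in>unit_circle. F z - G z = (\<Sum>l=-int n+1..int n-1. (z powi l) *\<^sub>C (\<sigma> l - \<tau> l))"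
    by (simp add: scaleC_diff_right sum_subtractf)
  then show ?thesis
    unfolding trig_polys_def by (intro CollectI exI[of _ "\<lambda>l. \<sigma> l - \<tau> l"])
qed

text \<open>Polarization: testing at \<open>A y + y\<close> and at \<open>A y\<close> plus
  \<open>\<i>\<close> times \<open>y\<close> gives two relations whose sum is twice
  \<open>cinner (A y) (A y)\<close>.\<close>

lemma cblinfun_eq_zeroI:
  fixes A :: "'a::chilbert_space \<Rightarrow>\<^sub>C\<^sub>L 'a"
  assumes "\<And>x. cinner x (cblinfun_apply A x) = 0"
  shows "A = 0"
proof (rule cblinfun_eqI)
  fix y
  let ?x = "cblinfun_apply A y"
  have "cinner ?x (cblinfun_apply A y) + cinner y (cblinfun_apply A ?x) = 0"
    using assms[of "?x + y"]
    by (simp add: cblinfun_apply_add_right cinner_add_left cinner_add_right assms add.commute)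
  moreover have "cinner ?x (cblinfun_apply A y) - cinner y (cblinfun_apply A ?x) = 0"
    using assms[of "?x + \<i> *\<^sub>C y"]
    by (simp add: cblinfun_apply_add_right cblinfun_apply_scaleC_right cinner_add_left
        cinner_add_right cinner_scaleC_left cinner_scaleC_right assms)
  ultimately have "cinner ?x ?x = 0"
    by simp
  then show "?x = cblinfun_apply 0 y"
    by (simp add: cinner_self zero_cblinfun.rep_eq)
qed

subsection \<open>Rank one minorants and pure elements\<close>

text \<open>The operator Fejer--Riesz factorization, reduced to the single rank one term that purity needs.\<close>

lemma trig_poly_rank_one_minorant:
  fixes F :: "complex \<Rightarrow> 'h::chilbert_space \<Rightarrow>\<^sub>C\<^sub>L 'h"
  assumes F: "F \<in> positive_trig_polys CARD('n::{finite,linorder})"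
    and z0: "z0 \<in> unit_circle" and h0: "cinner h0 (cblinfun_apply (F z0) h0) \<noteq> 0"
  obtains W :: "'n::{finite,linorder} \<Rightarrow> 'h" where
    "\<And>z h. z \<in> unit_circle \<Longrightarrow> (cmod (\<Sum>j\<in>UNIV. z ^ index_of j * cinner (W j) h))\<^sup>2
      \<le> Re (cinner h (cblinfun_apply (F z) h))"
    "(cmod (\<Sum>j\<in>UNIV. z0 ^ index_of j * cinner (W j) h0))\<^sup>2
      = Re (cinner h0 (cblinfun_apply (F z0) h0))"
proof -
  define d where "d = CARD('n) - 1"
  have d: "CARD('n) = Suc d"
    by (simp add: d_def)
  obtain \<sigma> where \<sigma>: "\<And>z. z \<in> unit_circle \<Longrightarrow>
      F z = (\<Sum>l=-int CARD('n)+1..int CARD('n)-1. (z powi l) *\<^sub>C \<sigma> l)"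
    using F unfolding positive_trig_polys_def trig_polys_def by blast
  \<comment> \<open>The coefficients outside the range of summation are arbitrary; setting them to 0
    makes the block Toeplitz matrix banded.\<close>
  define \<tau> where "\<tau> l = (if \<bar>l\<bar> \<le> int d then \<sigma> l else 0)" for l
  have supp: "\<tau> l = 0" if "int d < \<bar>l\<bar>" for l
    using that by (simp add: \<tau>_def)
  have F\<tau>: "F z = (\<Sum>l=-int d..int d. (z powi l) *\<^sub>C \<tau> l)" if "z \<in> unit_circle" for z
    unfolding \<sigma>[OF that] d by (intro sum.cong) (auto simp: \<tau>_def)
  have Fpos: "cinner h (cblinfun_apply (F z) h) \<in> \<real>\<^sub>\<ge>\<^sub>0" if "z \<in> unit_circle" for z h
    using F that by (auto simp: positive_trig_polys_def positive_cblinfun_def)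
  have nonneg: "0 \<le> toeplitz_form \<tau> N p" for N p
  proof (rule toeplitz_form_nonneg[OF supp])
    show "0 \<le> Re (cinner x (cblinfun_apply (\<Sum>l=-int d..int d. (z powi l) *\<^sub>C \<tau> l) x))"
      if "z \<in> unit_circle" for z x
      using Fpos[OF that, of x] by (simp add: F\<tau>[OF that] complex_nonneg_Reals_iff)
  qed
  \<comment> \<open>Reads a vector as a sequence. Its values from \<open>Suc d\<close> on are
    arbitrary, but Schur forms of order \<open>d\<close> and \<open>Suc d\<close> do not see
    them.\<close>
  define s where "s x k = x $ (inv index_of k :: 'n)" for x :: "'h ^ 'n::{finite,linorder}" and k
  define A where "A x = schur_form \<tau> (Suc d) (s x) - schur_form \<tau> d (s x)" for x
  define v where "v z h = (\<chi> j::'n. z ^ index_of j *\<^sub>C h)" for z and h :: 'h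
  have inj: "inj (index_of :: 'n \<Rightarrow> nat)"
    using bij_betw_index_of by (rule bij_betw_imp_inj_on)
  have index: "index_of (inv index_of k :: 'n) = k" if "k < Suc d" for k
    using that bij_betw_imp_surj_on[OF bij_betw_index_of[where 'n = 'n]] unfolding d
    by (intro f_inv_into_f) simp
  have s_add: "s (x + y) = (\<lambda>k. s x k + s y k)" and s_diff: "s (x - y) = (\<lambda>k. s x k - s y k)"
    and s_scale: "s (c *\<^sub>C x) = (\<lambda>k. c *\<^sub>C s x k)" for x y c
    by (simp_all add: s_def fun_eq_iff scaleC_vec_def)
  have Av: "A (v z h) = Re (cinner h (cblinfun_apply (F z) h))" if "z \<in> unit_circle" for z h
    unfolding A_def F\<tau>[OF that]
    by (rule schur_form_geometric[OF nonneg supp that]) (simp_all add: s_def v_def index)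
  have A_nonneg: "0 \<le> A x" for x
    by (simp add: A_def schur_form_mono[OF nonneg])
  have A_parallelogram: "A (x + y) + A (x - y) = 2 * A x + 2 * A y" for x y
    using schur_form_parallelogram[OF nonneg, of d "s x" "s y"]
      schur_form_parallelogram[OF nonneg, of "Suc d" "s x" "s y"]
    by (simp add: A_def s_add s_diff algebra_simps)
  have A_scale: "A (c *\<^sub>C x) = (cmod c)\<^sup>2 * A x" for c x
    by (simp add: A_def s_scale schur_form_scaleC[OF nonneg] algebra_simps)
  have "0 < A (v z0 h0)"
    using h0 Fpos[OF z0, of h0] by (simp add: Av[OF z0] complex_nonneg_Reals_iff complex_eq_iff)
  then obtain f where f_add: "\<And>x y. f (x + y) = f x + f y"
    and f_scale: "\<And>c x. f (c *\<^sub>C x) = c * f x"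
    and f_le: "\<And>x. (cmod (f x))\<^sup>2 \<le> A x" and f_eq: "(cmod (f (v z0 h0)))\<^sup>2 = A (v z0 h0)"
    by (rule quadratic_form_supporting_functional[OF A_nonneg A_parallelogram A_scale]) (rule that)
  \<comment> \<open>Padding \<open>h\<close> with zeros gives a competitor in the infimum, so
    \<open>A (axis j h)\<close> is at most \<open>Re (cinner h (\<tau> 0 h))\<close>. Each component
    of \<open>f\<close> is thus bounded, and the Riesz theorem represents it.\<close>
  have "\<exists>u. \<forall>h. f (axis j h) = cinner u h" for j
  proof -
    obtain K where K: "\<And>h. norm (cblinfun_apply (\<tau> 0) h) \<le> K * norm h"
      using cblinfun_apply_bounded_clinear[of "\<tau> 0"] by (auto simp: bounded_clinear_def)
    have "(cmod (f (axis j h)))\<^sup>2 \<le> (sqrt \<bar>K\<bar> * norm h)\<^sup>2" for h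
    proof -
      have "index_of j < Suc d"
        using bij_betw_index_of[where 'n = 'n] by (auto simp: bij_betw_def d)
      have "(cmod (f (axis j h)))\<^sup>2 \<le> A (axis j h)"
        by (rule f_le)
      also have "\<dots> \<le> schur_form \<tau> (Suc d) (s (axis j h))"
        by (simp add: A_def schur_form_nonneg[OF nonneg])
      also have "\<dots> \<le> toeplitz_form \<tau> (Suc d) (\<lambda>k. if k = index_of j then h else 0)"
      proof (rule schur_form_le[OF nonneg order_refl])
        show "(if k = index_of j then h else 0) = s (axis j h) k" if "k < Suc d" for k
          using index[OF that] inj by (auto simp: s_def axis_def)
      qed
      also have "\<dots> = Re (cinner h (cblinfun_apply (\<tau> 0) h))"
        using \<open>index_of j < Suc d\<close> by (rule toeplitz_form_single)
      also have "\<dots> \<le> norm h * norm (cblinfun_apply (\<tau> 0) h)"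
        using cinner_Cauchy_Schwarz complex_Re_le_cmod order_trans by blast
      also have "\<dots> \<le> norm h * (\<bar>K\<bar> * norm h)"
        using order_trans[OF K mult_right_mono[OF abs_ge_self norm_ge_zero]]
        by (intro mult_left_mono) simp_all
      also have "\<dots> = (sqrt \<bar>K\<bar> * norm h)\<^sup>2"
        by (simp add: power_mult_distrib power2_eq_square)
      finally show ?thesis .
    qed
    then have bound: "cmod (f (axis j h)) \<le> sqrt \<bar>K\<bar> * norm h" for h
      by (rule power2_le_imp_le) simp
    have axis_add: "axis j (g + h) = axis j g + axis j h" for g h :: 'h
      by (simp add: axis_def vec_eq_iff)
    have axis_scale: "axis j (c *\<^sub>C h) = c *\<^sub>C axis j h" for c and h :: 'h
      by (simp add: axis_def vec_eq_iff scaleC_vec_def)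
    obtain u where "\<And>h. f (axis j h) = cinner u h"
      by (rule Riesz_representation[of "\<lambda>h. f (axis j h)" "sqrt \<bar>K\<bar>"])
        (simp_all add: axis_add axis_scale f_add f_scale bound)
    then show ?thesis
      by blast
  qed
  then obtain W where W: "\<And>j h. f (axis j h) = cinner (W j) h"
    by metis
  have f0: "f 0 = 0"
    using f_add[of 0 0] by simp
  have f_sum: "f (\<Sum>j\<in>S. g j) = (\<Sum>j\<in>S. f (g j))" for S :: "'n set" and g
    by (induction S rule: infinite_finite_induct) (simp_all add: f0 f_add)
  have fv: "f (v z h) = (\<Sum>j\<in>UNIV. z ^ index_of j * cinner (W j) h)" for z h
  proof -
    have "v z h = (\<Sum>j\<in>UNIV. z ^ index_of j *\<^sub>C axis j h)"
      by (simp add: v_def vec_eq_iff scaleC_vec_def axis_def if_distrib cong: if_cong)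
    then show ?thesis
      by (simp add: f_sum f_scale W)
  qed
  show ?thesis
  proof (rule that)
    show "(cmod (\<Sum>j\<in>UNIV. z ^ index_of j * cinner (W j) h))\<^sup>2
        \<le> Re (cinner h (cblinfun_apply (F z) h))" if "z \<in> unit_circle" for z h
      using f_le[of "v z h"] by (simp add: fv Av[OF that])
    show "(cmod (\<Sum>j\<in>UNIV. z0 ^ index_of j * cinner (W j) h0))\<^sup>2
        = Re (cinner h0 (cblinfun_apply (F z0) h0))"
      using f_eq by (simp add: fv Av[OF z0])
  qed
qed

theorem proposition4p2:
  fixes n :: nat
    and F :: "complex \<Rightarrow> 'h::chilbert_space \<Rightarrow>\<^sub>C\<^sub>L 'h"
  assumes "n = CARD('n::{finite,linorder})"
    and "F \<in> positive_trig_polys n"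
    and "pure_in (positive_trig_polys n) F"
  shows "\<exists>w :: 'h \<Rightarrow>\<^sub>C\<^sub>L (complex ^ 'n::{finite,linorder}). \<forall>z\<in>unit_circle.
    F z = cadjoint w o\<^sub>C\<^sub>L cblinfun_of_matrix (toeplitz (inverse z)) o\<^sub>C\<^sub>L w"
proof -
  define \<theta> where "\<theta> W z = cadjoint (row_operator W) o\<^sub>C\<^sub>L cblinfun_of_matrix (toeplitz (inverse z))
    o\<^sub>C\<^sub>L row_operator W" for W :: "'n \<Rightarrow> 'h" and z
  have cinner_\<theta>: "cinner h (cblinfun_apply (\<theta> W z) h)
      = of_real ((cmod (\<Sum>j\<in>UNIV. z ^ index_of j * cinner (W j) h))\<^sup>2)"
    if "z \<in> unit_circle" for W z h
    unfolding \<theta>_def using that by (rule cinner_toeplitz_compression)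
  have "\<exists>W. \<forall>z\<in>unit_circle. F z = \<theta> W z"
  proof (cases "\<exists>z\<in>unit_circle. \<exists>h. cinner h (cblinfun_apply (F z) h) \<noteq> 0")
    case False
    \<comment> \<open>An operator is determined by its quadratic form, so \<open>F\<close> vanishes
      on the circle and the zero operator serves as \<open>w\<close>.\<close>
    have "F z = \<theta> (\<lambda>_. 0) z" if "z \<in> unit_circle" for z
    proof -
      have "F z = 0" "\<theta> (\<lambda>_. 0) z = 0"
        using False that by (auto intro!: cblinfun_eq_zeroI simp: cinner_\<theta>)
      then show ?thesis
        by simp
    qed
    then show ?thesis
      by blast
  next
    case True
    then obtain z0 h0 where z0: "z0 \<in> unit_circle"
      and h0: "cinner h0 (cblinfun_apply (F z0) h0) \<noteq> 0"
      by blast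
    have Fpos: "cinner h (cblinfun_apply (F z) h) \<in> \<real>\<^sub>\<ge>\<^sub>0" if "z \<in> unit_circle" for z h
      using assms(2) that by (auto simp: positive_trig_polys_def positive_cblinfun_def)
    obtain W :: "'n \<Rightarrow> 'h" where
      W_le: "\<And>z h. z \<in> unit_circle \<Longrightarrow> (cmod (\<Sum>j\<in>UNIV. z ^ index_of j * cinner (W j) h))\<^sup>2
        \<le> Re (cinner h (cblinfun_apply (F z) h))"
      and W_eq: "(cmod (\<Sum>j\<in>UNIV. z0 ^ index_of j * cinner (W j) h0))\<^sup>2
        = Re (cinner h0 (cblinfun_apply (F z0) h0))"
      by (rule trig_poly_rank_one_minorant[OF assms(2)[unfolded assms(1)] z0 h0]) (rule that)
    have \<theta>_trig: "\<theta> W \<in> trig_polys n"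
      unfolding assms(1) \<theta>_def by (rule toeplitz_compression_in_trig_polys)
    then have "\<theta> W \<in> positive_trig_polys n"
      by (auto simp: positive_trig_polys_def positive_cblinfun_def cinner_\<theta>)
    \<comment> \<open>The minorant property is positivity of the difference, so \<open>F\<close>
      splits inside the cone into \<open>\<theta> W\<close> and a remainder.\<close>
    moreover have "(\<lambda>z. F z - \<theta> W z) \<in> positive_trig_polys n"
      using assms(2) \<theta>_trig W_le Fpos
      by (auto simp: positive_trig_polys_def positive_cblinfun_def trig_polys_diff
          cblinfun_apply_diff_left cinner_diff_right cinner_\<theta> complex_nonneg_Reals_iff)
    ultimately obtain s where s: "\<forall>z\<in>unit_circle. \<theta> W z = s *\<^sub>R F z"
      using assms(3) unfolding pure_in_def by fastforce
    \<comment> \<open>Both forms take the same nonzero value at \<open>z0\<close> and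
      \<open>h0\<close>, which fixes \<open>s\<close>.\<close>
    have "Re (cinner h0 (cblinfun_apply (\<theta> W z0) h0)) = s * Re (cinner h0 (cblinfun_apply (F z0) h0))"
      using s z0 by (simp add: scaleR_cblinfun_def scaleC_cblinfun.rep_eq cinner_scaleC_right)
    then have "(s - 1) * Re (cinner h0 (cblinfun_apply (F z0) h0)) = 0"
      using z0 by (simp add: cinner_\<theta> W_eq left_diff_distrib)
    moreover have "Re (cinner h0 (cblinfun_apply (F z0) h0)) \<noteq> 0"
      using h0 Fpos[OF z0, of h0] by (simp add: complex_nonneg_Reals_iff complex_eq_iff)
    ultimately have "s = 1"
      by simp
    with s have "\<forall>z\<in>unit_circle. F z = \<theta> W z"
      by simp
    then show ?thesis
      by blast
  qed
  then show ?thesis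
    unfolding \<theta>_def by blast
qed

end
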